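(* Let $q$ be a prime power with $q\equiv 1\pmod 4$ and $q\not\equiv 1\pmod 3$. For every $x\in\mathbb{F}_{q^3}^{*}$, \[ \kappa_{1}(x) - \kappa_{-1}(x) = q\cdot \chi_{2}(x)\,\chi_{2}(\mathrm{T}(x)). \]
   Context: $\mathbb{E}=\mathbb{F}_{q^3}$, $\mathrm{T}(x)=x+x^q+x^{q^2}$ (trace to $\mathbb{F}_q$). Fix a primitive element $\alpha$ of $\mathbb{E}$ and put $\mu=\alpha^{q-1}$ (of order $q^2+q+1$). The quartic character $\chi_4$ of $\mathbb{E}$ is defined by $\chi_4(0)=0$, $\chi_4(\alpha^n)=\mathrm{i}^n$ with $\mathrm{i}=\sqrt{-1}\in\mathbb{C}$; $\overline{\chi_4}$ is its complex conjugate; $\chi_2=\chi_4^2$ is the quadratic character of $\mathbb{E}$ ($\chi_2(0)=0$). For $z\in\{1,\mathrm{i},-1,-\mathrm{i}\}$ and $x\in\mathbb{E}^*$, $\kappa_z(x)$ is the number of $i$ with $0\le i<q^2+q+1$ such that $\chi_4(\mathrm{T}(\mu^ix))\,\overline{\chi_4}(\mathrm{T}(\mu^{-i}x))=z$. *)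

theory Defs
  imports Complex_Main "HOL-Library.Cardinality" "HOL-Number_Theory.Number_Theory"
begin

definition primitive_element :: "'a::{field,finite} \<Rightarrow> bool" where
  "primitive_element \<alpha> \<longleftrightarrow> range (\<lambda>n::nat. \<alpha> ^ n) = UNIV - {0}"

text \<open>The trace from the field with \<open>q ^ 3\<close> elements to its subfield with \<open>q\<close> elements;
  its values are kept in the big field.\<close>

definition trace3 :: "nat \<Rightarrow> 'a::field \<Rightarrow> 'a" where
  "trace3 q x = x + x ^ q + x ^ (q ^ 2)"

text \<open>The discrete logarithm is made unique by taking the least exponent; the lemma
  \<open>chi4_power\<close> below shows that the choice is immaterial.\<close>

definition chi4 :: "'a::{field,finite} \<Rightarrow> 'a \<Rightarrow> complex" where
  "chi4 \<alpha> x = (if x = 0 then 0 else \<i> ^ (LEAST n::nat. x = \<alpha> ^ n))"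

definition chi2 :: "'a::{field,finite} \<Rightarrow> 'a \<Rightarrow> complex" where
  "chi2 \<alpha> x = (chi4 \<alpha> x) ^ 2"

definition kappa :: "nat \<Rightarrow> 'a::{field,finite} \<Rightarrow> complex \<Rightarrow> 'a \<Rightarrow> nat" where
  "kappa q \<alpha> z x =
     (let \<mu> = \<alpha> ^ (q - 1) in
      card {i. i < q ^ 2 + q + 1 \<and>
        chi4 \<alpha> (trace3 q (\<mu> ^ i * x)) * cnj (chi4 \<alpha> (trace3 q (inverse \<mu> ^ i * x))) = z})"

lemma primitive_element_nonzero: "primitive_element \<alpha> \<Longrightarrow> \<alpha> \<noteq> 0"
  unfolding primitive_element_def by (metis DiffE power_one_right rangeI singletonI)

lemma primitive_element_power_eq_1:
  fixes \<alpha> :: "'a::{field,finite}"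
  assumes "primitive_element \<alpha>" and "\<alpha> ^ d = 1"
  shows "(CARD('a) - 1) dvd d"
proof (cases "d = 0")
  case False
  define e where "e = (LEAST n. n > 0 \<and> \<alpha> ^ n = 1)"
  have e: "e > 0 \<and> \<alpha> ^ e = 1"
    unfolding e_def by (rule LeastI[of _ d]) (use False assms in auto)
  have min: "n = 0" if "n < e" "\<alpha> ^ n = 1" for n
    using not_less_Least[of n "\<lambda>n. n > 0 \<and> \<alpha> ^ n = 1"] that by (auto simp: e_def)
  have red: "\<alpha> ^ n = \<alpha> ^ (n mod e)" for n
  proof -
    have "\<alpha> ^ n = \<alpha> ^ (e * (n div e) + n mod e)" by simp
    also have "\<dots> = (\<alpha> ^ e) ^ (n div e) * \<alpha> ^ (n mod e)" by (simp only: power_add power_mult)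
    finally show ?thesis using e by simp
  qed
  have "inj_on (\<lambda>n. \<alpha> ^ n) {..<e}"
  proof (rule linorder_inj_onI')
    fix i j assume ij: "i \<in> {..<e}" "j \<in> {..<e}" "i < j"
    have "\<alpha> ^ j = \<alpha> ^ i * \<alpha> ^ (j - i)"
      using ij by (simp flip: power_add)
    moreover have "\<alpha> ^ (j - i) \<noteq> 1" using min[of "j - i"] ij less_imp_diff_less[of j e i] by auto
    ultimately show "\<alpha> ^ i \<noteq> \<alpha> ^ j"
      using primitive_element_nonzero[OF assms(1)] by auto
  qed
  moreover have "(\<lambda>n. \<alpha> ^ n) ` {..<e} = UNIV - {0}"
  proof -
    have "(\<lambda>n. \<alpha> ^ n) ` {..<e} = range (\<lambda>n. \<alpha> ^ n)"
    proof (intro equalityI subsetI)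
      fix y assume "y \<in> range (\<lambda>n. \<alpha> ^ n)"
      then obtain n where "y = \<alpha> ^ (n mod e)" using red by blast
      then show "y \<in> (\<lambda>n. \<alpha> ^ n) ` {..<e}" using e by auto
    qed auto
    then show ?thesis using assms(1) by (simp add: primitive_element_def)
  qed
  ultimately have "card (UNIV - {0::'a}) = e"
    using card_image[of "\<lambda>n. \<alpha> ^ n" "{..<e}"] by simp
  then have "CARD('a) - 1 = e" by (simp add: card_Diff_singleton)
  moreover have "d mod e = 0"
    using min[of "d mod e"] red[of d] assms(2) e by simp
  ultimately show ?thesis by auto
qed simp

lemma chi4_power:
  fixes \<alpha> :: "'a::{field,finite}"
  assumes "primitive_element \<alpha>" and "[CARD('a) = 1] (mod 4)"
  shows "chi4 \<alpha> (\<alpha> ^ n) = \<i> ^ n"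
proof -
  define m where "m = (LEAST k. \<alpha> ^ n = \<alpha> ^ k)"
  have m: "\<alpha> ^ n = \<alpha> ^ m" unfolding m_def by (rule LeastI) (rule refl)
  have le: "m \<le> n" unfolding m_def by (rule Least_le) (rule refl)
  have nz: "\<alpha> \<noteq> 0" by (rule primitive_element_nonzero[OF assms(1)])
  have "\<alpha> ^ m * \<alpha> ^ (n - m) = \<alpha> ^ m * 1"
    using m le by (simp flip: power_add)
  then have "\<alpha> ^ (n - m) = 1" using nz by simp
  then have "(CARD('a) - 1) dvd (n - m)"
    by (rule primitive_element_power_eq_1[OF assms(1)])
  moreover have "4 dvd CARD('a) - 1"
    using assms(2) by (rule cong_to_1_nat)
  ultimately have "4 dvd n - m" by (rule dvd_trans[rotated])
  then obtain k where k: "n = m + 4 * k" using le by (metis dvdE le_add_diff_inverse)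
  have "\<i> ^ n = \<i> ^ m" unfolding k by (simp add: power_add power_mult)
  then show ?thesis using nz by (simp add: chi4_def m_def)
qed

end

theory Submission
  imports Defs "HOL-Computational_Algebra.Polynomial"
begin

text \<open>
  Write \<open>F\<close> for the subfield with \<open>q\<close> elements and \<open>\<eta> = \<chi>\<^sup>2\<close>, where \<open>\<chi>\<close> is the quartic character.
  Since \<open>gcd (q\<^sup>2 + q + 1) (q - 1) = gcd 3 (q - 1) = 1\<close>, every unit is uniquely \<open>c * \<mu> ^ i\<close> with \<open>c\<close> a
  unit of \<open>F\<close>, and \<open>\<eta> y * \<chi> (T (y * x)) * cnj (\<chi> (T (x / y)))\<close> does not change under \<open>y \<mapsto> c * y\<close>.
  Hence the sum of this expression over all units \<open>y\<close> is \<open>q - 1\<close> times the sum whose real part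
  is \<open>\<kappa>\<^sub>1 - \<kappa>\<^sub>-\<^sub>1\<close>. Expanding the two values of \<open>\<chi>\<close> by Gauss sums over \<open>F\<close> turns it into a combination
  of Salie sums over the big field. These have a closed form, because
  \<open>\<eta> z\<close> summed over the solutions of \<open>z + 1/z = t\<close> is \<open>\<eta> (t + 2) + \<eta> (t - 2)\<close>. What remains is
  a constant built from Gauss sums, which is determined by \<open>G\<^sup>2 = q\<close>, \<open>\<eta> 2 = \<chi> (- 1)\<close> and the case
  \<open>G\<^sub>E = G\<^sup>3\<close> of the Davenport-Hasse relation for the quadratic Gauss sums \<open>G\<close> of \<open>F\<close> and \<open>G\<^sub>E\<close> of the big field.
\<close>

section \<open>Additive characters of finite fields\<close>

lemma prime_CHAR_finite: "prime CHAR('a::{field,finite})"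
  by (rule prime_CHAR_semidom) (rule finite_imp_CHAR_pos, simp)

text \<open>By induction with the freshman's dream every \<open>of_nat k\<close> is a root of
  \<open>X ^ p - X\<close>. These are \<open>p\<close> distinct elements, and the polynomial has at
  most \<open>p\<close> roots.\<close>

lemma prime_field_eq:
  "{z::'a::{field,finite}. z ^ CHAR('a) = z} = of_nat ` {..<CHAR('a)}"
proof -
  define p where "p = CHAR('a)"
  have p: "prime p" "p > 1" using prime_CHAR_finite[where 'a='a] prime_gt_1_nat by (auto simp: p_def)
  define P :: "'a poly" where "P = monom 1 p - monom 1 1"
  have cP: "coeff P p = 1" using p by (simp add: P_def)
  then have P0: "P \<noteq> 0" by auto
  have dP: "degree P \<le> p" unfolding P_def
    by (rule degree_diff_le) (use p in \<open>auto intro: order.trans[OF degree_monom_le]\<close>)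
  have roots: "{z. poly P z = 0} = {z. z ^ p = z}" by (auto simp: P_def poly_monom)
  have inj: "inj_on (of_nat :: nat \<Rightarrow> 'a) {..<p}"
    by (rule inj_onI) (auto simp: of_nat_eq_iff_cong_CHAR p_def cong_def)
  have "of_nat k ^ p = (of_nat k :: 'a)" for k
    by (induction k) (use p in \<open>auto simp: p_def freshmans_dream power_0_left\<close>)
  then have sub: "of_nat ` {..<p} \<subseteq> {z::'a. z ^ p = z}" by auto
  have "card {z::'a. z ^ p = z} \<le> card (of_nat ` {..<p} :: 'a set)"
    using card_poly_roots_bound[OF P0] dP inj by (simp add: roots card_image)
  then have "of_nat ` {..<p} = {z::'a. z ^ p = z}"
    using sub by (intro card_seteq) auto
  then show ?thesis by (simp add: p_def)
qed

text \<open>The character is \<open>exp (2 * pi * \<i> * tr t / p)\<close> with \<open>tr\<close>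
  the absolute trace down to the prime field. It is a homomorphism only on the solutions of
  \<open>t ^ q = t\<close>; elsewhere its values are arbitrary.\<close>

lemma exists_nontrivial_additive_character:
  fixes q n :: nat
  assumes q: "q = CHAR('a::{field,finite}) ^ n" and card: "card {t::'a. t ^ q = t} = q" and "q > 1"
  shows "\<exists>\<psi>::'a \<Rightarrow> complex. (\<forall>a b. a ^ q = a \<longrightarrow> b ^ q = b \<longrightarrow> \<psi> (a + b) = \<psi> a * \<psi> b)
           \<and> \<psi> 0 = 1 \<and> (\<exists>t. t ^ q = t \<and> \<psi> t \<noteq> 1)"
proof -
  define p where "p = CHAR('a)"
  have p: "prime p" "p > 1" using prime_CHAR_finite[where 'a='a] prime_gt_1_nat by (auto simp: p_def)
  have n: "n > 0" using assms by (auto intro!: Nat.gr0I)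
  define tr where "tr = (\<lambda>t::'a. \<Sum>k<n. t ^ (p ^ k))"
  have tr_add: "tr (a + b) = tr a + tr b" for a b
    using p freshmans_dream'[of "p ^ _" _ a b] by (simp add: tr_def sum.distrib p_def)
  have tr_frob: "tr t ^ p = tr t" if "t ^ q = t" for t
  proof -
    have "tr t ^ p = (\<Sum>k<n. (t ^ (p ^ k)) ^ p)"
      using p by (simp add: tr_def p_def freshmans_dream_sum)
    also have "\<dots> = (\<Sum>k<n. t ^ (p ^ Suc k))" by (simp add: mult.commute flip: power_mult)
    also have "\<dots> = (\<Sum>k=1..<Suc n. t ^ (p ^ k))"
      by (rule sum.reindex_bij_witness[of _ "\<lambda>k. k - 1" Suc]) auto
    finally have 1: "tr t ^ p = (\<Sum>k=1..<Suc n. t ^ (p ^ k))" .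
    \<comment> \<open>Frobenius permutes the summands cyclically: the sum of \<open>n + 1\<close>
      terms is split once at its first and once at its last term, and both of these equal
      \<open>t\<close>.\<close>
    have "(\<Sum>k<Suc n. t ^ (p ^ k)) = t ^ (p ^ 0) + (\<Sum>k=1..<Suc n. t ^ (p ^ k))"
      unfolding lessThan_atLeast0 by (subst sum.atLeast_Suc_lessThan) auto
    moreover have "(\<Sum>k<Suc n. t ^ (p ^ k)) = tr t + t" using that by (simp add: tr_def q p_def)
    ultimately show ?thesis using 1 by simp
  qed
  have "\<exists>k<p. tr t = of_nat k" if "t ^ q = t" for t
    using tr_frob[OF that] prime_field_eq[where 'a='a] by (auto simp: p_def)
  then obtain K where K: "\<And>t. t ^ q = t \<Longrightarrow> K t < p \<and> tr t = of_nat (K t)" by metis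
  define e where "e = (\<lambda>k::nat. cis (2 * pi * real k / real p))"
  have e_add: "e (j + k) = e j * e k" for j k
    by (simp add: e_def cis_mult add_divide_distrib ring_distribs)
  have bij: "bij_betw e {..<p} {z. z ^ p = 1}"
    unfolding e_def using p by (intro bij_betw_roots_unity) auto
  have e_p: "e (p * k) = 1" for k
    using p cis_multiple_2pi[of "real k"] by (simp add: e_def mult_ac)
  \<comment> \<open>\<open>K\<close> picks integer representatives of traces and is additive only
    modulo \<open>p\<close>, so \<open>e\<close> has to depend on the residue alone.\<close>
  have e_mod: "e (k mod p) = e k" for k
  proof -
    have "e k = e (p * (k div p) + k mod p)" by simp
    also have "\<dots> = e (k mod p)" by (simp only: e_add e_p) simp
    finally show ?thesis by simp
  qed
  define \<psi> where "\<psi> = (\<lambda>t. e (K t))"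
  have add: "\<psi> (a + b) = \<psi> a * \<psi> b" if "a ^ q = a" "b ^ q = b" for a b
  proof -
    have "(a + b) ^ q = a + b" using that freshmans_dream'[OF prime_CHAR_finite q] by simp
    then have "of_nat (K (a + b)) = (of_nat (K a + K b) :: 'a)"
      using K[of "a + b"] K[OF that(1)] K[OF that(2)] tr_add[of a b] by (metis of_nat_add)
    then have "K (a + b) mod p = (K a + K b) mod p"
      by (simp add: of_nat_eq_iff_cong_CHAR cong_def p_def del: of_nat_add)
    then show ?thesis unfolding \<psi>_def by (metis e_mod e_add)
  qed
  have "\<psi> 0 * \<psi> 0 = \<psi> 0" "\<psi> 0 \<noteq> 0" using add[of 0 0] \<open>q > 1\<close> by (auto simp: power_0_left \<psi>_def e_def)
  then have zero: "\<psi> 0 = 1" by simp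
  have "\<exists>t. t ^ q = t \<and> tr t \<noteq> 0"
  proof (rule ccontr)
    assume no: "\<nexists>t. t ^ q = t \<and> tr t \<noteq> 0"
    \<comment> \<open>If \<open>tr\<close> vanished on the subfield, this polynomial of degree at
      most \<open>p ^ (n - 1)\<close> would have at least \<open>q = p ^ n\<close> roots.\<close>
    define P :: "'a poly" where "P = (\<Sum>k<n. monom 1 (p ^ k))"
    have "coeff P (p ^ (n - 1)) = (\<Sum>k<n. if k = n - 1 then 1 else 0)"
      unfolding P_def using p by (auto simp: coeff_sum intro!: sum.cong dest: power_inject_exp[THEN iffD1, rotated])
    then have "coeff P (p ^ (n - 1)) = 1" using n by simp
    then have P0: "P \<noteq> 0" by auto
    have deg: "degree P \<le> p ^ (n - 1)" unfolding P_def
      by (rule degree_sum_le) (use p in \<open>auto intro!: order.trans[OF degree_monom_le] power_increasing\<close>)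
    have "{t. t ^ q = t} \<subseteq> {t. poly P t = 0}"
      using no by (auto simp: P_def poly_sum poly_monom tr_def)
    then have "q \<le> card {t. poly P t = 0}" by (subst card[symmetric]) (auto intro: card_mono)
    also have "\<dots> \<le> p ^ (n - 1)" using card_poly_roots_bound[OF P0] deg by simp
    also have "\<dots> < p ^ n" using p n by (intro power_strict_increasing) auto
    finally show False using q by (simp add: p_def)
  qed
  then obtain t where t: "t ^ q = t" "tr t \<noteq> 0" by blast
  have "\<psi> t \<noteq> 1"
  proof
    assume "\<psi> t = 1"
    then have "e (K t) = e 0" by (simp add: \<psi>_def e_def)
    then have "K t = 0" using bij K[OF t(1)] p by (auto simp: bij_betw_def inj_on_def)
    then show False using K[OF t(1)] t by simp
  qed
  then show ?thesis using add zero t by (intro exI[of _ \<psi>]) auto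
qed

section \<open>The subfield, the trace and the multiplicative characters\<close>

text \<open>Writing \<open>q\<close> as a power of the characteristic makes
  \<open>x \<mapsto> x ^ q\<close> additive. The subfield is later realised inside the big field as
  the fixed points of this map.\<close>

locale cubic_extension =
  fixes q n :: nat and \<alpha> :: "'a::{field,finite}"
  assumes q_eq: "q = CHAR('a) ^ n" and q_mod4: "[q = 1] (mod 4)" and q_mod3: "\<not> [q = 1] (mod 3)"
    and card_E: "CARD('a) = q ^ 3" and prim: "primitive_element \<alpha>"
begin

abbreviation T :: "'a \<Rightarrow> 'a" where "T \<equiv> trace3 q"
abbreviation \<chi> :: "'a \<Rightarrow> complex" where "\<chi> \<equiv> chi4 \<alpha>"
abbreviation \<eta> :: "'a \<Rightarrow> complex" where "\<eta> \<equiv> chi2 \<alpha>"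
definition F :: "'a set" where "F = {t. t ^ q = t}"
definition N :: nat where "N = q ^ 2 + q + 1"

section \<open>Arithmetic of \<open>q\<close> and \<open>N\<close>\<close>

lemma q_gt_1: "q > 1"
proof -
  have "card {0, 1::'a} \<le> q ^ 3" unfolding card_E[symmetric] by (rule card_mono) auto
  then have *: "2 \<le> q ^ 3" by simp
  show ?thesis
  proof (rule ccontr)
    assume "\<not> ?thesis"
    then have "q = 0 \<or> q = 1" by linarith
    then show False using * by auto
  qed
qed

lemma q_obtain: obtains k where "q = 4 * k + 1" "k > 0"
proof -
  have "q mod 4 = 1" using q_mod4 by (simp add: cong_def)
  then have "q = 4 * (q div 4) + 1" by presburger
  then show ?thesis using that[of "q div 4"] q_gt_1 by (cases "q div 4 = 0") auto
qed

lemma E_minus_1: "q ^ 3 - 1 = (q - 1) * N"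
proof -
  obtain k where "q = k + 1" using q_gt_1 by (metis add.commute less_imp_add_positive)
  then show ?thesis unfolding N_def by (simp add: power3_eq_cube power2_eq_square algebra_simps)
qed

lemma N_mod4: "N mod 4 = 3"
proof -
  obtain k where k: "q = 4 * k + 1" by (rule q_obtain)
  have "N = 4 * (4 * k * k + 3 * k) + 3"
    unfolding N_def by (simp add: k power2_eq_square algebra_simps)
  then show ?thesis by presburger
qed

lemma E_mod4: "[CARD('a) = 1] (mod 4)"
  using cong_pow[OF q_mod4, of 3] by (simp add: card_E)

text \<open>With \<open>k = q - 1\<close> one has \<open>N = k * (k + 3) + 3\<close>, so a common
  divisor divides 3, and 3 does not divide \<open>q - 1\<close>.\<close>

lemma coprime_N: "coprime N (q - 1)"
proof -
  obtain k where k: "q = k + 1" using q_gt_1 by (metis add.commute less_imp_add_positive)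
  have N: "N = k * (k + 3) + 3"
    unfolding N_def by (simp add: k power2_eq_square algebra_simps)
  have "q mod 3 \<noteq> 1" using q_mod3 by (simp add: cong_def)
  then have "\<not> 3 dvd k" using k by presburger
  then have "coprime 3 k" by (intro prime_imp_coprime) auto
  have "coprime (k * (k + 3) + 3) k"
  proof (rule coprimeI)
    fix d assume "d dvd k * (k + 3) + 3" "d dvd k"
    then have "d dvd 3" by (simp add: dvd_add_right_iff)
    then show "is_unit d" using \<open>coprime 3 k\<close> \<open>d dvd k\<close> coprime_common_divisor by blast
  qed
  then show ?thesis using N k by simp
qed

section \<open>Powers of \<alpha> and the units of the subfield\<close>

lemma alpha_nz: "\<alpha> \<noteq> 0" using prim by (rule primitive_element_nonzero)

lemma pow_E: "x ^ (q ^ 3) = (x::'a)"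
proof (cases "x = 0")
  case False
  then obtain m where m: "x = \<alpha> ^ m" using prim unfolding primitive_element_def by blast
  have "\<alpha> ^ 0 = \<alpha> ^ (q^3 - 1)"
  proof -
    \<comment> \<open>Multiplication by \<alpha> permutes the units; comparing the products of all
      units gives \<open>\<alpha> ^ (q^3 - 1) = 1\<close>.\<close>
    have "(\<Prod>y\<in>UNIV-{0}. \<alpha> * y) = (\<Prod>y\<in>UNIV-{0}. y)"
      using alpha_nz by (intro prod.reindex_bij_witness[of _ "\<lambda>y. y / \<alpha>" "\<lambda>y. \<alpha> * y"]) auto
    moreover have "(\<Prod>y\<in>UNIV-{0}. \<alpha> * y) = \<alpha> ^ (q^3 - 1) * (\<Prod>y\<in>UNIV-{0}. y)"
      by (simp add: prod.distrib card_Diff_singleton card_E)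
    moreover have "(\<Prod>y\<in>UNIV-{0::'a}. y) \<noteq> 0" by simp
    ultimately show ?thesis by simp
  qed
  then have "x ^ (q^3 - 1) = 1" unfolding m by (metis power_0 power_mult mult.commute power_one)
  then have "x * x ^ (q^3 - 1) = x" by simp
  moreover have "q ^ 3 = Suc (q ^ 3 - 1)" using q_gt_1 by simp
  ultimately show ?thesis by (metis power_Suc)
qed (use q_gt_1 in simp)

lemma alpha_power_eq_1_iff: "\<alpha> ^ m = 1 \<longleftrightarrow> (q - 1) * N dvd m"
proof
  assume "\<alpha> ^ m = 1"
  from primitive_element_power_eq_1[OF prim this] show "(q - 1) * N dvd m"
    unfolding card_E E_minus_1 .
next
  assume "(q - 1) * N dvd m"
  then obtain k where k: "m = (q ^ 3 - 1) * k" unfolding E_minus_1 by blast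
  have "\<alpha> * \<alpha> ^ (q ^ 3 - 1) = \<alpha>" using pow_E[of \<alpha>] q_gt_1
    by (metis One_nat_def Suc_pred not_gr_zero one_less_power power_Suc zero_less_numeral zero_less_power less_trans zero_less_one)
  then show "\<alpha> ^ m = 1" using alpha_nz by (simp add: k power_mult)
qed

lemma obtain_log: assumes "x \<noteq> 0" obtains m where "x = \<alpha> ^ m"
  using assms prim unfolding primitive_element_def by blast

lemma alpha_power_in_F: "\<alpha> ^ m \<in> F \<longleftrightarrow> N dvd m"
proof -
  have "(\<alpha> ^ m) ^ q = \<alpha> ^ m * (\<alpha> ^ m) ^ (q - 1)"
    using q_gt_1 by (metis One_nat_def Suc_pred less_trans power_Suc zero_less_one)
  then have "\<alpha> ^ m \<in> F \<longleftrightarrow> \<alpha> ^ (m * (q - 1)) = 1"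
    using alpha_nz by (simp add: F_def flip: power_mult)
  also have "\<dots> \<longleftrightarrow> N * (q - 1) dvd m * (q - 1)" by (simp add: alpha_power_eq_1_iff mult.commute)
  also have "\<dots> \<longleftrightarrow> N dvd m" using q_gt_1 by simp
  finally show ?thesis .
qed

lemma alpha_power_inj: assumes "\<alpha> ^ i = \<alpha> ^ j" "i < (q-1)*N" "j < (q-1)*N" shows "i = j"
  using assms
proof (induction i j rule: linorder_wlog)
  case (le i j)
  have "\<alpha> ^ j = \<alpha> ^ i * \<alpha> ^ (j - i)" using le(1) by (simp flip: power_add)
  then have "\<alpha> ^ (j - i) = 1" using le alpha_nz by simp
  then have "(q-1)*N dvd j - i" by (simp add: alpha_power_eq_1_iff)
  then show ?case using le by (metis diff_diff_cancel diff_zero dvd_imp_le less_imp_diff_less linorder_not_le nat_neq_iff zero_less_diff)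
next
  case (sym i j) then show ?case by metis
qed

lemma F_units: "F - {0} = (\<lambda>k. \<alpha> ^ (N * k)) ` {..<q - 1}"
proof (intro equalityI subsetI)
  fix x assume x: "x \<in> F - {0}"
  then obtain m where m: "x = \<alpha> ^ m" using obtain_log by blast
  then obtain k where k: "m = N * k" using alpha_power_in_F x by auto
  have "\<alpha> ^ (N * k) = \<alpha> ^ ((q-1) * N * (k div (q-1)) + N * (k mod (q-1)))"
    by (metis mult.assoc mult.commute mult_div_mod_eq distrib_left)
  also have "\<dots> = \<alpha> ^ (N * (k mod (q-1)))"
    using alpha_power_eq_1_iff[of "(q-1) * N * (k div (q-1))"] by (simp add: power_add)
  finally show "x \<in> (\<lambda>k. \<alpha> ^ (N * k)) ` {..<q - 1}" using m k q_gt_1 by auto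
next
  fix x assume "x \<in> (\<lambda>k. \<alpha> ^ (N * k)) ` {..<q - 1}"
  then obtain k where "x = \<alpha> ^ (N * k)" by blast
  then show "x \<in> F - {0}" using alpha_nz alpha_power_in_F[of "N * k"] by simp
qed

lemma card_F_units: "card (F - {0}) = q - 1"
  unfolding F_units
proof (subst card_image)
  show "inj_on (\<lambda>k. \<alpha> ^ (N * k)) {..<q - 1}"
  proof (rule inj_onI)
    fix i j assume *: "i \<in> {..<q - 1}" "j \<in> {..<q - 1}" "\<alpha> ^ (N * i) = \<alpha> ^ (N * j)"
    have N: "N > 0" by (simp add: N_def)
    then have "N * i = N * j" using * by (intro alpha_power_inj) (auto simp: mult.commute)
    then show "i = j" using N by simp
  qed
qed simp

lemma zero_F [simp]: "0 \<in> F" using q_gt_1 by (simp add: F_def)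
lemma one_F [simp]: "1 \<in> F" by (simp add: F_def)

lemma card_F: "card F = q"
proof -
  have "card F = Suc (card (F - {0}))" by (rule card.remove) auto
  then show ?thesis using card_F_units q_gt_1 by simp
qed

section \<open>Frobenius, closure of the subfield, and linearity of the trace\<close>

lemma frob_add: "(x + y) ^ q = x ^ q + (y ^ q :: 'a)"
  by (rule freshmans_dream'[OF prime_CHAR_finite q_eq])

lemma frob_uminus: "(- x) ^ q = - (x ^ q :: 'a)"
proof -
  have "odd q" by (rule q_obtain) auto
  then show ?thesis by simp
qed

lemma frob_diff: "(x - y) ^ q = x ^ q - (y ^ q :: 'a)"
  using frob_add[of x "-y"] frob_uminus by simp

lemma F_closed [intro]:
  "a \<in> F \<Longrightarrow> b \<in> F \<Longrightarrow> a + b \<in> F" "a \<in> F \<Longrightarrow> b \<in> F \<Longrightarrow> a - b \<in> F"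
  "a \<in> F \<Longrightarrow> b \<in> F \<Longrightarrow> a * b \<in> F" "a \<in> F \<Longrightarrow> b \<in> F \<Longrightarrow> a / b \<in> F"
  "a \<in> F \<Longrightarrow> - a \<in> F" "a \<in> F \<Longrightarrow> inverse a \<in> F" "a \<in> F \<Longrightarrow> a ^ k \<in> F"
  by (simp_all add: F_def frob_add frob_diff frob_uminus power_mult_distrib power_divide power_inverse
      mult.commute[of k] flip: power_mult) (simp add: power_mult)

lemma numeral_F [simp]: "numeral k \<in> F"
proof -
  have "of_nat m \<in> F" for m by (induction m) (auto)
  from this[of "numeral k"] show ?thesis by simp
qed

lemma T_eq: "T x = x + x ^ q + (x ^ q) ^ q" by (simp add: trace3_def power2_eq_square power_mult)

lemma frob_frob_frob: "((x ^ q) ^ q) ^ q = (x::'a)"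
  using pow_E[of x] by (simp add: power3_eq_cube power_mult)

lemma T_in_F [simp]: "T x \<in> F" by (simp add: F_def T_eq frob_add frob_frob_frob)
lemma T_add: "T (x + y) = T x + T y" by (simp add: T_eq frob_add)
lemma T_diff: "T (x - y) = T x - T y" by (simp add: T_eq frob_diff)
lemma T_scale: "c \<in> F \<Longrightarrow> T (c * x) = c * T x"
  by (simp add: T_eq power_mult_distrib F_def algebra_simps)
lemma T_F: "c \<in> F \<Longrightarrow> T c = 3 * c" by (simp add: T_eq F_def)
lemma T_0 [simp]: "T 0 = 0" using T_F[of 0] by simp

lemma two_nz: "(2::'a) \<noteq> 0"
proof
  assume "(2::'a) = 0"
  then have "of_nat 2 = (0::'a)" by simp
  then have "CHAR('a) dvd 2" by (simp only: of_nat_eq_0_iff_char_dvd)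
  then have "CHAR('a) = 2" using prime_CHAR_finite[where 'a='a] by (metis primes_dvd_imp_eq two_is_prime_nat)
  then have "even q \<or> q = 1" using q_eq by auto
  then show False using q_obtain q_gt_1 by (metis even_add even_mult_iff even_numeral odd_one nat_neq_iff)
qed

section \<open>The quartic and the quadratic character\<close>

lemma chi_0 [simp]: "\<chi> 0 = 0" by (simp add: chi4_def)
lemma eta_0 [simp]: "\<eta> 0 = 0" by (simp add: chi2_def)

lemma chi_alpha_power: "\<chi> (\<alpha> ^ m) = \<i> ^ m"
  by (rule chi4_power[OF prim E_mod4])

lemma chi_1 [simp]: "\<chi> 1 = 1" using chi_alpha_power[of 0] by simp
lemma eta_1 [simp]: "\<eta> 1 = 1" by (simp add: chi2_def)

lemma chi_mult: "\<chi> (x * y) = \<chi> x * \<chi> y"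
proof (cases "x = 0 \<or> y = 0")
  case False
  then obtain i j where "x = \<alpha> ^ i" "y = \<alpha> ^ j" by (metis obtain_log)
  then show ?thesis by (simp add: chi_alpha_power flip: power_add)
qed auto

lemma eta_mult: "\<eta> (x * y) = \<eta> x * \<eta> y"
  by (simp add: chi2_def chi_mult power_mult_distrib)

lemma eta_alpha_power: "\<eta> (\<alpha> ^ m) = (- 1) ^ m"
  by (simp add: chi2_def chi_alpha_power mult.commute[of m] flip: power_mult)

lemma norm_chi: "x \<noteq> 0 \<Longrightarrow> norm (\<chi> x) = 1"
  by (metis obtain_log chi_alpha_power norm_ii norm_power power_one)

lemma chi_nz: "x \<noteq> 0 \<Longrightarrow> \<chi> x \<noteq> 0" using norm_chi by fastforce

lemma cnj_chi: "cnj (\<chi> x) = \<chi> (inverse x)"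
proof (cases "x = 0")
  case False
  have "\<chi> x * \<chi> (inverse x) = 1" using False by (simp flip: chi_mult)
  moreover have "\<chi> x * cnj (\<chi> x) = 1"
    using norm_chi[OF False] by (simp add: complex_norm_square[symmetric])
  ultimately show ?thesis using chi_nz[OF False] by (metis mult_left_cancel)
qed simp

lemma eta_cases: "x \<noteq> 0 \<Longrightarrow> \<eta> x = 1 \<or> \<eta> x = - 1"
  by (metis obtain_log eta_alpha_power neg_one_even_power neg_one_odd_power)

lemma eta_square: "x \<noteq> 0 \<Longrightarrow> \<eta> x * \<eta> x = 1" using eta_cases by force

lemma eta_inverse: "\<eta> (inverse x) = \<eta> x"
proof (cases "x = 0")
  case False
  have "\<eta> x * \<eta> (inverse x) = 1" using False by (simp flip: eta_mult)
  then show ?thesis using eta_cases[OF False] by (auto simp: minus_equation_iff)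
qed simp

lemma eta_power2: "x \<noteq> 0 \<Longrightarrow> \<eta> (x\<^sup>2) = 1"
  by (simp add: power2_eq_square eta_mult eta_square)

lemma eta_divide: "\<eta> (x / y) = \<eta> x * \<eta> y"
  by (simp add: divide_inverse eta_mult eta_inverse)

lemma eta_eq_1_imp_square: assumes "\<eta> x = 1" obtains c where "c\<^sup>2 = x" "c \<noteq> 0"
proof -
  have "x \<noteq> 0" using assms by auto
  then obtain m where m: "x = \<alpha> ^ m" by (rule obtain_log)
  then have "even m" using assms by (auto simp: eta_alpha_power minus_one_power_iff split: if_splits)
  then obtain k where "m = 2 * k" by blast
  then show ?thesis using that[of "\<alpha> ^ k"] m alpha_nz by (simp add: mult.commute flip: power_mult)
qed

lemma chi_power2: "\<chi> (x\<^sup>2) = \<eta> x" by (simp add: chi2_def power2_eq_square chi_mult)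

lemma eta_minus_1: "\<eta> (- 1) = 1" using chi_power2[of "-1"] by simp

lemma eta_uminus: "\<eta> (- x) = \<eta> x" using eta_mult[of "-1" x] eta_minus_1 by simp

text \<open>If \<open>j\<close> is a square root of -1, then \<open>2 * j\<close> is the square of
  \<open>1 + j\<close>, hence \<open>\<eta> 2 = \<eta> j = \<chi> (j\<^sup>2)\<close>.\<close>

lemma eta_2: "\<eta> 2 = \<chi> (- 1)"
proof -
  obtain j :: 'a where j: "j\<^sup>2 = -1" and "j \<noteq> 0" by (rule eta_eq_1_imp_square[OF eta_minus_1])
  have "1 + j \<noteq> 0"
  proof
    assume "1 + j = 0"
    then have "j = -1" by (metis add_eq_0_iff)
    then have "1 = (- 1 :: 'a)" using j by simp
    then have "1 + 1 = (0 :: 'a)" by (simp only: eq_neg_iff_add_eq_0)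
    then show False using two_nz by simp
  qed
  then have "\<eta> ((1 + j)\<^sup>2) = 1" by (rule eta_power2)
  moreover have "(1 + j)\<^sup>2 = 2 * j" using j by (simp add: power2_eq_square algebra_simps)
  ultimately have "\<eta> 2 * \<eta> j = 1" "\<eta> j * \<eta> j = 1" using \<open>j \<noteq> 0\<close> by (simp_all add: eta_mult eta_square)
  then have "\<eta> 2 = \<eta> j" by (metis mult.assoc mult.commute mult_1)
  then show ?thesis using chi_power2[of j] j by simp
qed

text \<open>The degree 3 is odd: if Frobenius sent \<open>r\<close> to \<open>- r\<close>, its third
  iterate, the identity, would do so too. Thus \<open>\<eta>\<close> restricts to the quadratic
  character of \<open>F\<close>.\<close>

lemma sqrt_in_F: assumes "r\<^sup>2 \<in> F" shows "r \<in> F"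
proof -
  have "(r ^ q)\<^sup>2 = r\<^sup>2" using assms by (simp add: F_def mult.commute flip: power_mult)
  then have "r ^ q = r \<or> r ^ q = - r" by (simp add: power2_eq_iff)
  moreover have False if "r ^ q = - r" "r \<noteq> 0"
  proof -
    have "r = - r" using frob_frob_frob[of r] that by (simp add: frob_uminus)
    then have "2 * r = 0" by (simp add: eq_neg_iff_add_eq_0)
    then show False using that two_nz by simp
  qed
  ultimately show ?thesis by (cases "r = 0") (auto simp: F_def)
qed

section \<open>Sums over squares and substitutions in sums\<close>

lemma card_sqrts: "of_nat (card {y. y\<^sup>2 = c}) = 1 + \<eta> c"
proof (cases "c = 0")
  case False
  show ?thesis
  proof (cases "\<eta> c = 1")
    case True
    then obtain r where r: "r\<^sup>2 = c" "r \<noteq> 0" by (rule eta_eq_1_imp_square)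
    have "{y. y\<^sup>2 = c} = {r, - r}" using r by (auto simp: power2_eq_iff)
    moreover have "r \<noteq> - r" using r two_nz by (simp add: eq_neg_iff_add_eq_0 flip: mult_2)
    ultimately show ?thesis using True by simp
  next
    case nsq: False
    then have "{y. y\<^sup>2 = c} = {}" using eta_power2 False by force
    then show ?thesis using nsq eta_cases[OF False] by simp
  qed
qed simp

lemma sum_over_squares: "(\<Sum>y\<in>UNIV. h (y\<^sup>2)) = (\<Sum>c\<in>UNIV. (1 + \<eta> c) * h c)"
proof -
  have "(\<Sum>y\<in>UNIV. h (y\<^sup>2)) = (\<Sum>c\<in>UNIV. \<Sum>y | y \<in> UNIV \<and> y\<^sup>2 = c. h (y\<^sup>2))"
    by (rule sum.group[symmetric]) auto
  also have "\<dots> = (\<Sum>c\<in>UNIV. (1 + \<eta> c) * h c)"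
    by (rule sum.cong) (simp_all add: card_sqrts)
  finally show ?thesis .
qed

lemma sum_over_squares_F: "(\<Sum>y\<in>F. h (y\<^sup>2)) = (\<Sum>c\<in>F. (1 + \<eta> c) * h c)"
proof -
  have "(\<Sum>y\<in>F. h (y\<^sup>2)) = (\<Sum>c\<in>F. \<Sum>y | y \<in> F \<and> y\<^sup>2 = c. h (y\<^sup>2))"
    by (rule sum.group[symmetric]) auto
  also have "\<dots> = (\<Sum>c\<in>F. (1 + \<eta> c) * h c)"
  proof (rule sum.cong)
    fix c assume "c \<in> F"
    then have "{y. y \<in> F \<and> y\<^sup>2 = c} = {y. y\<^sup>2 = c}" using sqrt_in_F by auto
    then show "(\<Sum>y | y \<in> F \<and> y\<^sup>2 = c. h (y\<^sup>2)) = (1 + \<eta> c) * h c" by (simp add: card_sqrts)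
  qed simp
  finally show ?thesis .
qed

lemma sum_F_scale: "c \<in> F \<Longrightarrow> c \<noteq> 0 \<Longrightarrow> (\<Sum>t\<in>F. h (c * t)) = (\<Sum>t\<in>F. h t)"
  by (rule sum.reindex_bij_witness[of _ "\<lambda>t. t / c" "\<lambda>t. c * t"]) auto

lemma sum_F_shift: "c \<in> F \<Longrightarrow> (\<Sum>t\<in>F. h (t + c)) = (\<Sum>t\<in>F. h t)"
  by (rule sum.reindex_bij_witness[of _ "\<lambda>t. t - c" "\<lambda>t. t + c"]) auto

lemma sum_E_scale: "c \<noteq> 0 \<Longrightarrow> (\<Sum>t\<in>UNIV. h (c * t)) = (\<Sum>t\<in>UNIV. h (t::'a))"
  by (rule sum.reindex_bij_witness[of _ "\<lambda>t. t / c" "\<lambda>t. c * t"]) auto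

lemma sum_E_shift: "(\<Sum>t\<in>UNIV. h (t + c)) = (\<Sum>t\<in>UNIV. h (t::'a))"
  by (rule sum.reindex_bij_witness[of _ "\<lambda>t. t - c" "\<lambda>t. t + c"]) auto

text \<open>The witness \<open>\<alpha> ^ N\<close> generates the units of \<open>F\<close>, and it
  is a nonsquare because \<open>N\<close> is odd.\<close>

lemma eta_nontrivial_F: "\<exists>c\<in>F. c \<noteq> 0 \<and> \<eta> c \<noteq> 1"
proof
  have "odd N" using N_mod4 by presburger
  then have "\<eta> (\<alpha> ^ N) = -1" by (simp add: eta_alpha_power)
  then show "\<alpha> ^ N \<noteq> 0 \<and> \<eta> (\<alpha> ^ N) \<noteq> 1" using alpha_nz by simp
  show "\<alpha> ^ N \<in> F" by (simp add: alpha_power_in_F)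
qed

text \<open>Nontriviality is demanded on \<open>F\<close> and not merely on the big field, since the
  Gauss sums run over \<open>F\<close>.\<close>

definition mult_char :: "('a \<Rightarrow> complex) \<Rightarrow> bool" where
  "mult_char f \<longleftrightarrow> (\<forall>a b. f (a * b) = f a * f b) \<and> f 0 = 0 \<and> f 1 = 1 \<and> (\<exists>c\<in>F. c \<noteq> 0 \<and> f c \<noteq> 1)"

lemma mult_char_eta: "mult_char \<eta>"
  using eta_nontrivial_F by (simp add: mult_char_def eta_mult)

lemma mult_char_chi: "mult_char \<chi>"
  using eta_nontrivial_F by (auto simp: mult_char_def chi_mult chi2_def)

lemma mult_char_inverse: assumes "mult_char f" shows "mult_char (\<lambda>x. f (inverse x))"
proof -
  obtain c where "c \<in> F" "c \<noteq> 0" "f c \<noteq> 1" using assms by (auto simp: mult_char_def)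
  then have "\<exists>c\<in>F. c \<noteq> 0 \<and> f (inverse c) \<noteq> 1" by (intro bexI[of _ "inverse c"]) auto
  then show ?thesis using assms by (simp add: mult_char_def)
qed

lemma mult_charD: assumes "mult_char f" shows "f (a * b) = f a * f b" "f 0 = 0" "f 1 = 1"
  using assms by (auto simp: mult_char_def)

lemma sum_mult_char: assumes "mult_char f" shows "(\<Sum>t\<in>F. f t) = 0"
proof -
  obtain c where c: "c \<in> F" "c \<noteq> 0" "f c \<noteq> 1" using assms by (auto simp: mult_char_def)
  have "(\<Sum>t\<in>F. f t) = f c * (\<Sum>t\<in>F. f t)"
    using sum_F_scale[OF c(1,2), of f] by (simp add: mult_charD[OF assms] sum_distrib_left)
  then show ?thesis using c by (metis mult_cancel_right1)
qed



text \<open>The trace is a polynomial function of degree \<open>q\<^sup>2\<close>, too small to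
  vanish at all \<open>q ^ 3\<close> elements.\<close>

lemma T_nontrivial: "\<exists>z. T z \<noteq> 0"
proof (rule ccontr)
  assume no: "\<nexists>z. T z \<noteq> 0"
  define P :: "'a poly" where "P = monom 1 1 + monom 1 q + monom 1 (q\<^sup>2)"
  have "q < q\<^sup>2" using q_gt_1 by (simp add: power2_eq_square)
  then have "coeff P (q\<^sup>2) = 1" using q_gt_1 by (auto simp: P_def)
  then have P0: "P \<noteq> 0" by auto
  have deg: "degree P \<le> q\<^sup>2" unfolding P_def using q_gt_1 \<open>q < q\<^sup>2\<close>
    by (intro degree_add_le) (auto intro!: order.trans[OF degree_monom_le])
  have "{t. poly P t = 0} = UNIV"
    using no by (auto simp: P_def poly_monom trace3_def)
  then have "q ^ 3 \<le> q\<^sup>2" using card_poly_roots_bound[OF P0] deg card_E by simp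
  then show False using q_gt_1 by (simp add: power_increasing_iff)
qed

lemma T_surj: assumes "d \<in> F" obtains z where "T z = d"
proof -
  obtain z where z: "T z \<noteq> 0" using T_nontrivial by blast
  have "d / T z \<in> F" using assms by auto
  then have "T (d / T z * z) = d / T z * T z" by (rule T_scale)
  also have "\<dots> = d" using z by simp
  finally have "T (d / T z * z) = d" .
  then show ?thesis by (rule that)
qed

text \<open>The order \<open>(q - 1) * N\<close> of the unit group is prime to 3: the first factor
  by assumption, the second because \<open>N\<close> is 1 modulo 3 when \<open>q\<close> is 0 or 2
  modulo 3.\<close>

lemma cube_root_of_unity: assumes "l ^ 3 = (1::'a)" shows "l = 1"
proof -
  have "l \<noteq> 0" using assms by auto
  then obtain m where m: "l = \<alpha> ^ m" by (rule obtain_log)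
  have "\<not> 3 dvd q - 1" using q_mod3 q_gt_1 by (metis cong_altdef_nat less_or_eq_imp_le)
  moreover have "\<not> 3 dvd N"
  proof -
    have "q mod 3 = 0 \<or> q mod 3 = 2" using q_mod3 by (simp add: cong_def) presburger
    then obtain k where "q = 3 * k \<or> q = 3 * k + 2" by (metis add_0_right mult_div_mod_eq)
    then have "N = 3 * (3 * k * k + k) + 1 \<or> N = 3 * (3 * k * k + 5 * k + 2) + 1"
      unfolding N_def by (auto simp: power2_eq_square algebra_simps)
    then obtain m where "N = 3 * m + 1" by blast
    then show ?thesis by presburger
  qed
  ultimately have "coprime ((q - 1) * N) 3"
    by (intro iffD1[OF coprime_commute prime_imp_coprime]) (auto simp: prime_dvd_mult_iff)
  moreover have "(q - 1) * N dvd m * 3" using assms by (simp add: m alpha_power_eq_1_iff flip: power_mult)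
  ultimately have "(q - 1) * N dvd m" by (simp add: coprime_dvd_mult_left_iff)
  then show ?thesis by (simp add: m alpha_power_eq_1_iff)
qed

text \<open>Elements of \<open>F\<close> have trace \<open>3 * c\<close>, so subtracting a third of
  its trace moves an element outside \<open>F\<close> into the kernel without killing it.\<close>

lemma exists_trace_zero_nz: assumes "(3::'a) \<noteq> 0" obtains w where "T w = 0" "w \<noteq> 0"
proof -
  have "F \<noteq> UNIV"
  proof
    assume "F = UNIV"
    then have "q = q ^ 3" using card_F card_E by simp
    then show False using q_gt_1 power_strict_increasing[of 1 3 q] by simp
  qed
  then obtain y where y: "y \<notin> F" by blast
  have F: "inverse 3 * T y \<in> F" by auto
  then have "T (y - inverse 3 * T y) = 0" using assms by (simp add: T_diff T_F)
  moreover have "y - inverse 3 * T y \<noteq> 0" using y F by (metis eq_iff_diff_eq_0)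
  ultimately show ?thesis by (rule that)
qed

end

section \<open>Gauss sums\<close>

locale cubic_extension_char = cubic_extension +
  fixes \<psi> :: "'a \<Rightarrow> complex"
  assumes psi_add: "a \<in> F \<Longrightarrow> b \<in> F \<Longrightarrow> \<psi> (a + b) = \<psi> a * \<psi> b"
    and psi_0 [simp]: "\<psi> 0 = 1"
    and psi_nontrivial: "\<exists>t\<in>F. \<psi> t \<noteq> 1"
begin

definition gauss :: "('a \<Rightarrow> complex) \<Rightarrow> complex" where
  "gauss f = (\<Sum>t\<in>F. f t * \<psi> t)"

text \<open>The lift of the additive character from \<open>F\<close> to the big field;
  \<open>gaussE\<close> is the quadratic Gauss sum belonging to it.\<close>

definition \<Psi> :: "'a \<Rightarrow> complex" where "\<Psi> y = \<psi> (T y)"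

definition gaussE :: complex where "gaussE = (\<Sum>y\<in>UNIV. \<eta> y * \<Psi> y)"

lemma Psi_add: "\<Psi> (x + y) = \<Psi> x * \<Psi> y" by (simp add: \<Psi>_def T_add psi_add)

lemma sum_psi: assumes "a \<in> F" shows "(\<Sum>t\<in>F. \<psi> (a * t)) = (if a = 0 then of_nat q else 0)"
proof (cases "a = 0")
  case False
  obtain c where c: "c \<in> F" "\<psi> c \<noteq> 1" using psi_nontrivial by blast
  have "(\<Sum>t\<in>F. \<psi> t) = (\<Sum>t\<in>F. \<psi> t) * \<psi> c"
    using sum_F_shift[OF c(1), of \<psi>] c(1) by (simp add: psi_add sum_distrib_right)
  then have "(\<Sum>t\<in>F. \<psi> t) = 0" using c by (metis mult_cancel_left1 mult.commute)
  then show ?thesis using sum_F_scale[OF assms False, of \<psi>] False by simp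
qed (simp add: card_F)

lemma sum_Psi: "(\<Sum>y\<in>UNIV. \<Psi> y) = 0"
proof -
  obtain c where c: "c \<in> F" "\<psi> c \<noteq> 1" using psi_nontrivial by blast
  obtain z where z: "T z = c" by (rule T_surj[OF c(1)])
  have "(\<Sum>y\<in>UNIV. \<Psi> y) = (\<Sum>y\<in>UNIV. \<Psi> y) * \<Psi> z"
    using sum_E_shift[of \<Psi> z] by (simp add: Psi_add sum_distrib_right)
  then show ?thesis using c z by (metis mult_cancel_left1 mult.commute \<Psi>_def)
qed

text \<open>For \<open>t \<noteq> 0\<close> substitute \<open>s / t\<close> for \<open>s\<close>. At
  \<open>t = 0\<close> both sides vanish, as \<open>f\<close> sums to 0 over \<open>F\<close>; hence
  the formula also expands the character at a zero trace.\<close>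

lemma gauss_twist:
  assumes f: "mult_char f" and t: "t \<in> F"
  shows "(\<Sum>s\<in>F. f s * \<psi> (s * t)) = f (inverse t) * gauss f"
proof (cases "t = 0")
  case True
  then show ?thesis using sum_mult_char[OF f] by (simp add: mult_charD[OF f])
next
  case False
  have "(\<Sum>s\<in>F. f s * \<psi> (s * t)) = (\<Sum>s\<in>F. f (inverse t * (t * s)) * \<psi> (t * s))"
    by (rule sum.cong) (use False in \<open>simp_all add: mult.commute[of _ t] flip: mult.assoc\<close>)
  also have "\<dots> = (\<Sum>s\<in>F. f (inverse t * s) * \<psi> s)"
    by (rule sum_F_scale[OF t False])
  finally show ?thesis by (simp add: mult_charD[OF f] gauss_def sum_distrib_left mult.assoc)
qed

text \<open>After substituting \<open>t * u\<close> for \<open>s\<close>, the sum over nonzero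
  \<open>t\<close> is \<open>q - 1\<close> for \<open>u = - 1\<close> and -1 for every other
  \<open>u\<close>; the contributions of -1 cancel because \<open>f\<close> sums to 0.\<close>

lemma gauss_mult_gauss_inverse:
  assumes f: "mult_char f"
  shows "gauss f * gauss (\<lambda>x. f (inverse x)) = f (- 1) * of_nat q"
proof -
  have "gauss f * gauss (\<lambda>x. f (inverse x)) = (\<Sum>t\<in>F. \<Sum>s\<in>F. f s * \<psi> s * (f (inverse t) * \<psi> t))"
    unfolding gauss_def sum_product by (rule sum.swap)
  also have "\<dots> = (\<Sum>t\<in>F-{0}. \<Sum>s\<in>F. f s * \<psi> s * (f (inverse t) * \<psi> t))"
    by (rule sum.mono_neutral_right) (auto simp: mult_charD[OF f])
  also have "\<dots> = (\<Sum>t\<in>F-{0}. \<Sum>u\<in>F. f u * \<psi> ((u + 1) * t))"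
  proof (rule sum.cong)
    fix t assume t: "t \<in> F - {0}"
    have "(\<Sum>s\<in>F. f s * \<psi> s * (f (inverse t) * \<psi> t))
        = (\<Sum>u\<in>F. f (t * u) * \<psi> (t * u) * (f (inverse t) * \<psi> t))"
      by (rule sum_F_scale[symmetric]) (use t in auto)
    also have "\<dots> = (\<Sum>u\<in>F. f u * \<psi> ((u + 1) * t))"
    proof (rule sum.cong)
      fix u assume u: "u \<in> F"
      have "f t * f (inverse t) = 1" using t by (simp add: mult_charD(3)[OF f] flip: mult_charD(1)[OF f])
      moreover have "\<psi> ((u + 1) * t) = \<psi> (t * u) * \<psi> t"
        using t u by (subst psi_add[symmetric]) (auto simp: algebra_simps)
      ultimately show "f (t * u) * \<psi> (t * u) * (f (inverse t) * \<psi> t) = f u * \<psi> ((u + 1) * t)"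
        by (simp add: mult_charD(1)[OF f])
    qed simp
    finally show "(\<Sum>s\<in>F. f s * \<psi> s * (f (inverse t) * \<psi> t)) = (\<Sum>u\<in>F. f u * \<psi> ((u + 1) * t))" .
  qed simp
  also have "\<dots> = (\<Sum>u\<in>F. f u * (\<Sum>t\<in>F-{0}. \<psi> ((u + 1) * t)))"
    by (subst sum.swap) (simp add: sum_distrib_left)
  also have "\<dots> = (\<Sum>u\<in>F. f u * ((if u + 1 = 0 then of_nat q else 0) - 1))"
  proof (rule sum.cong)
    fix u assume u: "u \<in> F"
    have "(\<Sum>t\<in>F. \<psi> ((u + 1) * t)) = (\<Sum>t\<in>F-{0}. \<psi> ((u + 1) * t)) + 1"
      by (subst sum.remove[of F 0]) auto
    then have "(\<Sum>t\<in>F-{0}. \<psi> ((u + 1) * t)) = (if u + 1 = 0 then of_nat q else 0) - 1"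
      using sum_psi[of "u + 1"] F_closed(1)[OF u one_F] by (auto simp: eq_diff_eq)
    then show "f u * (\<Sum>t\<in>F-{0}. \<psi> ((u + 1) * t)) = f u * ((if u + 1 = 0 then of_nat q else 0) - 1)"
      by simp
  qed simp
  also have "\<dots> = (\<Sum>u\<in>F. if u = - 1 then f u * of_nat q else 0) - (\<Sum>u\<in>F. f u)"
    unfolding sum_subtractf[symmetric]
    by (rule sum.cong) (auto simp: right_diff_distrib add_eq_0_iff2)
  also have "\<dots> = f (- 1) * of_nat q"
    using F_closed(5)[OF one_F] by (simp add: sum_mult_char[OF f])
  finally show ?thesis .
qed

lemma gauss_eta_square: "gauss \<eta> * gauss \<eta> = of_nat q"
  using gauss_mult_gauss_inverse[OF mult_char_eta] by (simp add: eta_inverse eta_minus_1)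

lemma sum_psi_square: assumes "a \<in> F" "a \<noteq> 0" shows "(\<Sum>t\<in>F. \<psi> (a * t\<^sup>2)) = \<eta> a * gauss \<eta>"
proof -
  have "(\<Sum>t\<in>F. \<psi> (a * t\<^sup>2)) = (\<Sum>c\<in>F. (1 + \<eta> c) * \<psi> (a * c))"
    by (rule sum_over_squares_F)
  also have "\<dots> = (\<Sum>c\<in>F. \<psi> (a * c)) + (\<Sum>c\<in>F. \<eta> c * \<psi> (c * a))"
    by (simp add: ring_distribs sum.distrib mult.commute)
  also have "\<dots> = \<eta> a * gauss \<eta>"
    using assms by (simp add: sum_psi gauss_twist[OF mult_char_eta] eta_inverse)
  finally show ?thesis .
qed

section \<open>The quadratic Gauss sum of the big field\<close>

lemma gaussE_eq_sum_squares: "gaussE = (\<Sum>y\<in>UNIV. \<Psi> (y\<^sup>2))"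
  unfolding sum_over_squares[of \<Psi>] gaussE_def using sum_Psi by (simp add: ring_distribs sum.distrib)

lemma gaussE_twist: assumes "c \<noteq> 0" shows "(\<Sum>y\<in>UNIV. \<eta> y * \<Psi> (c * y)) = \<eta> c * gaussE"
proof -
  have "(\<Sum>y\<in>UNIV. \<eta> y * \<Psi> (c * y)) = (\<Sum>y\<in>UNIV. \<eta> (inverse c * (c * y)) * \<Psi> (c * y))"
    by (rule sum.cong) (use assms in \<open>simp_all flip: mult.assoc\<close>)
  also have "\<dots> = (\<Sum>y\<in>UNIV. \<eta> (inverse c * y) * \<Psi> y)"
    by (rule sum_E_scale[OF assms])
  finally show ?thesis by (simp add: eta_mult eta_inverse gaussE_def sum_distrib_left mult.assoc)
qed

text \<open>In the basis \<open>1\<close>, \<open>w\<close>, \<open>w + 2 * w'\<close> over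
  \<open>F\<close>, the form \<open>T (y\<^sup>2)\<close> is diagonal with coefficients
  \<open>3\<close>, \<open>A\<close>, \<open>3 * A\<close>. Their product is a square, so the values
  of \<open>\<eta>\<close> cancel and the cube of \<open>gauss \<eta>\<close> remains.\<close>

lemma gaussE_eq_char_not_3: assumes three: "(3::'a) \<noteq> 0" shows "gaussE = of_nat q * gauss \<eta>"
proof -
  obtain w where w: "T w = 0" "w \<noteq> 0" by (rule exists_trace_zero_nz[OF three])
  define w' where "w' = w ^ q"
  define A where "A = T (w\<^sup>2)"
  have w'': "w' ^ q = - w - w'" using w(1) by (simp add: T_eq w'_def) (metis add_eq_0_iff minus_add_distrib diff_conv_add_uminus)
  have w''': "(- w - w') ^ q = w" using frob_frob_frob[of w] by (simp add: w'_def[symmetric] w'')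
  have A_eq: "A = 2 * (w\<^sup>2 + w * w' + w'\<^sup>2)"
    unfolding A_def T_eq
    by (simp add: power_mult_distrib power2_eq_square w'_def[symmetric] w'' algebra_simps)
  have not_F: "w' \<noteq> w" using w three T_F[of w] by (auto simp: F_def w'_def)
  \<comment> \<open>If \<open>A\<close> were 0, the quotient \<open>w' / w\<close> would be a cube
    root of unity other than 1.\<close>
  have A_nz: "A \<noteq> 0"
  proof
    assume "A = 0"
    then have "2 * (w\<^sup>2 + w * w' + w'\<^sup>2) = 0" using A_eq by simp
    then have 0: "w\<^sup>2 + w * w' + w'\<^sup>2 = 0" using two_nz mult_eq_0_iff by blast
    have "w' ^ 3 - w ^ 3 = (w' - w) * (w\<^sup>2 + w * w' + w'\<^sup>2)"
      by (simp add: power2_eq_square power3_eq_cube algebra_simps)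
    then have "w' ^ 3 = w ^ 3" using 0 by simp
    then have "(w' / w) ^ 3 = 1" using w by (simp add: power_divide)
    then have "w' / w = 1" by (rule cube_root_of_unity)
    then show False using not_F w by simp
  qed
  have A_F: "A \<in> F" by (simp add: A_def)
  \<comment> \<open>The coordinates are chosen to diagonalise the quadratic form \<open>T (y\<^sup>2)\<close>.\<close>
  define \<phi> where "\<phi> = (\<lambda>(r, s, t). r + (s + t) * w + 2 * t * w')"
  have indep: "r = 0 \<and> s = 0 \<and> t = 0" if F: "r \<in> F" "s \<in> F" "t \<in> F" and 0: "r + s * w + t * w' = 0" for r s t
  proof -
    have Tw': "T w' = 0" using w(1) by (simp add: T_eq w'_def frob_frob_frob algebra_simps)
    have "T (r + s * w + t * w') = 3 * r"
      using F w Tw' by (simp add: T_add T_scale T_F)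
    then have r: "r = 0" using 0 three by simp
    have t: "t = 0"
    proof (rule ccontr)
      assume "t \<noteq> 0"
      \<comment> \<open>A relation with \<open>t \<noteq> 0\<close> makes \<open>w\<close> an
        eigenvector of Frobenius with eigenvalue \<open>l\<close> in \<open>F\<close>; three
        applications force \<open>l ^ 3 = 1\<close>.\<close>
      define l where "l = - s / t"
      have l: "w ^ q = l * w" using 0 r \<open>t \<noteq> 0\<close>
        by (simp add: l_def w'_def field_simps add_eq_0_iff2)
      have lF: "l ^ q = l" using F by (auto simp: l_def F_def power_divide frob_uminus)
      have "w = l ^ 3 * w" using frob_frob_frob[of w]
        by (simp add: l lF power_mult_distrib power3_eq_cube mult.assoc)
      then have "l ^ 3 = 1" using w by simp
      then have "l = 1" by (rule cube_root_of_unity)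
      then show False using l not_F by (simp add: w'_def)
    qed
    then show ?thesis using 0 r w by simp
  qed
  have inj: "inj_on \<phi> (F \<times> F \<times> F)"
  proof (rule inj_onI)
    fix u v assume "u \<in> F \<times> F \<times> F" "v \<in> F \<times> F \<times> F" "\<phi> u = \<phi> v"
    then obtain r s t r' s' t' where uv: "u = (r, s, t)" "v = (r', s', t')"
      and F: "r \<in> F" "s \<in> F" "t \<in> F" "r' \<in> F" "s' \<in> F" "t' \<in> F"
      and eq: "\<phi> (r, s, t) = \<phi> (r', s', t')" by blast
    have "(r - r') + ((s + t) - (s' + t')) * w + (2 * (t - t')) * w' = 0"
      using eq by (simp add: \<phi>_def algebra_simps)
    then have "r - r' = 0 \<and> (s + t) - (s' + t') = 0 \<and> 2 * (t - t') = 0"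
      by (rule indep[rotated 3]) (use F in \<open>auto intro!: F_closed numeral_F simp del: right_diff_distrib_numeral\<close>)
    then show "u = v" using two_nz by (auto simp: uv)
  qed
  have "card (\<phi> ` (F \<times> F \<times> F)) = CARD('a)"
    using card_image[OF inj] by (simp add: card_cartesian_product card_F card_E power3_eq_cube)
  then have surj: "\<phi> ` (F \<times> F \<times> F) = UNIV" by (metis card_subset_eq finite subset_UNIV)
  have Tsq: "T ((\<phi> (r, s, t))\<^sup>2) = 3 * r\<^sup>2 + A * s\<^sup>2 + (3 * A) * t\<^sup>2"
    if F: "r \<in> F" "s \<in> F" "t \<in> F" for r s t
  proof -
    have y1: "\<phi> (r, s, t) ^ q = r + (s + t) * w' + 2 * t * (- w - w')"
      using F numeral_F[of "num.Bit0 num.One"]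
      by (simp add: \<phi>_def frob_add power_mult_distrib F_def w'_def[symmetric] w'')
    have y2: "(\<phi> (r, s, t) ^ q) ^ q = r + (s + t) * (- w - w') + 2 * t * w"
      using F numeral_F[of "num.Bit0 num.One"] unfolding y1
      by (simp add: frob_add power_mult_distrib F_def w'' w''')
    have "T ((\<phi> (r, s, t))\<^sup>2) = (\<phi> (r, s, t))\<^sup>2 + (\<phi> (r, s, t) ^ q)\<^sup>2 + ((\<phi> (r, s, t) ^ q) ^ q)\<^sup>2"
      unfolding T_eq by (simp add: power2_eq_square power_mult_distrib)
    also have "\<dots> = 3 * r\<^sup>2 + A * s\<^sup>2 + (3 * A) * t\<^sup>2"
      unfolding y2 unfolding y1 A_eq by (simp add: \<phi>_def power2_eq_square algebra_simps)
    finally show ?thesis .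
  qed
  have "gaussE = (\<Sum>y\<in>\<phi> ` (F \<times> F \<times> F). \<Psi> (y\<^sup>2))" by (simp add: gaussE_eq_sum_squares surj)
  also have "\<dots> = (\<Sum>v\<in>F \<times> F \<times> F. \<Psi> ((\<phi> v)\<^sup>2))" by (simp add: sum.reindex[OF inj])
  also have "\<dots> = (\<Sum>(r, s, t)\<in>F \<times> F \<times> F. \<psi> (3 * r\<^sup>2) * (\<psi> (A * s\<^sup>2) * \<psi> ((3 * A) * t\<^sup>2)))"
  proof (rule sum.cong)
    fix v assume "v \<in> F \<times> F \<times> F"
    then obtain r s t where v: "v = (r, s, t)" and F: "r \<in> F" "s \<in> F" "t \<in> F" by blast
    have "3 * r\<^sup>2 \<in> F" "A * s\<^sup>2 \<in> F" "(3 * A) * t\<^sup>2 \<in> F" using F A_F by (auto intro!: F_closed)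
    then show "\<Psi> ((\<phi> v)\<^sup>2) = (case v of (r, s, t) \<Rightarrow> \<psi> (3 * r\<^sup>2) * (\<psi> (A * s\<^sup>2) * \<psi> ((3 * A) * t\<^sup>2)))"
      unfolding v \<Psi>_def Tsq[OF F] by (simp add: psi_add F_closed(1))
  qed simp
  also have "\<dots> = (\<Sum>r\<in>F. \<psi> (3 * r\<^sup>2)) * ((\<Sum>s\<in>F. \<psi> (A * s\<^sup>2)) * (\<Sum>t\<in>F. \<psi> ((3 * A) * t\<^sup>2)))"
    unfolding sum_product sum.cartesian_product by (rule sum.cong) auto
  also have "\<dots> = (\<eta> 3 * gauss \<eta>) * ((\<eta> A * gauss \<eta>) * (\<eta> (3 * A) * gauss \<eta>))"
    using three A_nz A_F by (subst (1 2 3) sum_psi_square) auto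
  also have "\<dots> = (\<eta> 3 * \<eta> 3) * (\<eta> A * \<eta> A) * (gauss \<eta> * gauss \<eta>) * gauss \<eta>"
    by (simp add: eta_mult)
  also have "\<dots> = of_nat q * gauss \<eta>"
    using three A_nz by (simp add: eta_square gauss_eta_square del: mult.assoc)
  finally show ?thesis .
qed

text \<open>Let \<open>D\<close> be Frobenius minus the identity; then \<open>D (D y) = T y\<close>
  in characteristic 3. On the kernel of the trace, \<open>T (y\<^sup>2)\<close> is minus the square
  of \<open>D y\<close>, and \<open>D\<close> maps this kernel onto \<open>F\<close> with fibres of
  size \<open>q\<close>. This leaves \<open>q\<close> times a quadratic Gauss sum over
  \<open>F\<close>.\<close>

lemma gaussE_eq_char_3: assumes three: "(3::'a) = 0" shows "gaussE = of_nat q * gauss \<eta>"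
proof -
  define D where "D = (\<lambda>y::'a. y ^ q - y)"
  have t0: "3 * z = 0" for z :: 'a using three by simp
  have DD: "D (D y) = T y" for y
  proof -
    have "D (D y) = T y - 3 * y ^ q" by (simp add: D_def T_eq frob_diff algebra_simps)
    then show ?thesis by (simp only: t0 diff_zero)
  qed
  have D_diff: "D (y - z) = D y - D z" for y z by (simp add: D_def frob_diff)
  have D_add: "D (y + z) = D y + D z" for y z by (simp add: D_def frob_add)
  have D_zero: "D y = 0 \<longleftrightarrow> y \<in> F" for y by (simp add: D_def F_def)
  have Tsq: "T (y\<^sup>2) = (- 1) * (D y)\<^sup>2" if "T y = 0" for y
  proof -
    have 1: "y ^ q = y + D y" by (simp add: D_def)
    have "D y ^ q = D y" using DD[of y] that D_zero[of "D y"] by (simp add: F_def)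
    then have 2: "(y ^ q) ^ q = y + D y + D y" by (subst 1, simp only: frob_add) (simp only: 1)
    have "T (y\<^sup>2) = y\<^sup>2 + (y ^ q)\<^sup>2 + ((y ^ q) ^ q)\<^sup>2"
      unfolding T_eq by (simp add: power2_eq_square power_mult_distrib)
    also have "\<dots> = y\<^sup>2 + (y + D y)\<^sup>2 + (y + D y + D y)\<^sup>2" unfolding 2 unfolding 1 ..
    also have "\<dots> = 3 * (y\<^sup>2 + 2 * (y * D y) + 2 * (D y)\<^sup>2) + (- 1) * (D y)\<^sup>2"
      by (simp add: power2_eq_square algebra_simps)
    finally show ?thesis by (simp only: t0 add_0)
  qed
  \<comment> \<open>In characteristic 3, \<open>1\<close> is isotropic for \<open>T (y\<^sup>2)\<close>: averaging over the shifts by \<open>F\<close> leaves only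
    the kernel of the trace.\<close>
  have "of_nat q * gaussE = (\<Sum>s\<in>F. \<Sum>y\<in>UNIV. \<Psi> ((y + s)\<^sup>2))"
    by (simp add: sum_E_shift[of "\<lambda>y. \<Psi> (y\<^sup>2)"] card_F gaussE_eq_sum_squares)
  also have "\<dots> = (\<Sum>y\<in>UNIV. \<Sum>s\<in>F. \<Psi> ((y + s)\<^sup>2))" by (rule sum.swap)
  also have "\<dots> = (\<Sum>y\<in>UNIV. if T y = 0 then of_nat q * \<Psi> (y\<^sup>2) else 0)"
  proof (rule sum.cong)
    fix y :: 'a
    have "(\<Sum>s\<in>F. \<Psi> ((y + s)\<^sup>2)) = (\<Sum>s\<in>F. \<Psi> (y\<^sup>2) * \<psi> ((2 * T y) * s))"
    proof (rule sum.cong)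
      fix s assume s: "s \<in> F"
      have "(y + s)\<^sup>2 = y\<^sup>2 + ((2 * s) * y + s\<^sup>2)" by (simp add: power2_eq_square algebra_simps)
      moreover have "T ((2 * s) * y) = (2 * T y) * s" using s by (subst T_scale) auto
      moreover have "T (s\<^sup>2) = 0" using s three by (subst T_F) auto
      ultimately have "T ((y + s)\<^sup>2) = T (y\<^sup>2) + (2 * T y) * s" by (simp add: T_add)
      moreover have "(2 * T y) * s \<in> F" using s by (intro F_closed) auto
      ultimately show "\<Psi> ((y + s)\<^sup>2) = \<Psi> (y\<^sup>2) * \<psi> ((2 * T y) * s)" by (simp add: \<Psi>_def psi_add)
    qed simp
    also have "\<dots> = \<Psi> (y\<^sup>2) * (\<Sum>s\<in>F. \<psi> ((2 * T y) * s))" by (simp add: sum_distrib_left)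
    also have "\<dots> = (if T y = 0 then of_nat q * \<Psi> (y\<^sup>2) else 0)"
      using two_nz by (subst sum_psi) auto
    finally show "(\<Sum>s\<in>F. \<Psi> ((y + s)\<^sup>2)) = (if T y = 0 then of_nat q * \<Psi> (y\<^sup>2) else 0)" .
  qed simp
  also have "\<dots> = (\<Sum>y | T y = 0. of_nat q * \<Psi> (y\<^sup>2))" by (simp add: sum.If_cases)
  also have "\<dots> = of_nat q * (\<Sum>y | T y = 0. \<psi> ((- 1) * (D y)\<^sup>2))"
    unfolding sum_distrib_left by (rule sum.cong) (auto simp: \<Psi>_def Tsq)
  finally have "gaussE = (\<Sum>y | T y = 0. \<psi> ((- 1) * (D y)\<^sup>2))" using q_gt_1 by simp
  also have "\<dots> = (\<Sum>d\<in>F. \<Sum>y | y \<in> {y. T y = 0} \<and> D y = d. \<psi> ((- 1) * (D y)\<^sup>2))"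
    by (rule sum.group[symmetric]) (auto simp: D_zero[symmetric] DD)
  also have "\<dots> = (\<Sum>d\<in>F. of_nat q * \<psi> ((- 1) * d\<^sup>2))"
  proof (rule sum.cong)
    fix d assume d: "d \<in> F"
    \<comment> \<open>Since \<open>D (D z) = T z\<close>, the point \<open>D z\<close> lies in the
      fibre over \<open>d\<close>, which is therefore the coset \<open>D z + F\<close>.\<close>
    obtain z where z: "T z = d" by (rule T_surj[OF d])
    have "{y. y \<in> {y. T y = 0} \<and> D y = d} = (\<lambda>u. D z + u) ` F"
    proof (intro equalityI subsetI)
      fix y assume "y \<in> {y. y \<in> {y. T y = 0} \<and> D y = d}"
      then have "D (y - D z) = 0" using z by (simp add: D_diff DD)
      then have "y - D z \<in> F" by (simp add: D_zero)
      then show "y \<in> (\<lambda>u. D z + u) ` F" by (intro image_eqI[of _ _ "y - D z"]) auto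
    next
      fix y assume "y \<in> (\<lambda>u. D z + u) ` F"
      then obtain u where u: "u \<in> F" "y = D z + u" by blast
      have "D y = d" using u z D_zero[of u] by (simp add: D_add DD)
      moreover have "T y = 0" using DD[of y] \<open>D y = d\<close> d D_zero[of d] by simp
      ultimately show "y \<in> {y. y \<in> {y. T y = 0} \<and> D y = d}" by simp
    qed
    then have "card {y. y \<in> {y. T y = 0} \<and> D y = d} = q" by (simp add: card_image card_F)
    then show "(\<Sum>y | y \<in> {y. T y = 0} \<and> D y = d. \<psi> ((- 1) * (D y)\<^sup>2)) = of_nat q * \<psi> ((- 1) * d\<^sup>2)"
      by simp
  qed simp
  also have "\<dots> = of_nat q * (\<Sum>d\<in>F. \<psi> ((- 1) * d\<^sup>2))" by (rule sum_distrib_left[symmetric])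
  also have "\<dots> = of_nat q * gauss \<eta>"
    using F_closed(5)[OF one_F] by (subst sum_psi_square) (auto simp: eta_minus_1)
  finally show ?thesis .
qed

lemma gaussE_eq: "gaussE = of_nat q * gauss \<eta>"
  using gaussE_eq_char_3 gaussE_eq_char_not_3 by blast

end

section \<open>Salie sums\<close>

context cubic_extension
begin

text \<open>A nonempty fibre is \<open>{z, inverse z}\<close>, and \<open>z * (t + 2)\<close>,
  \<open>z * (t - 2)\<close> are the squares of \<open>z + 1\<close>, \<open>z - 1\<close>, so each
  term on the right is \<open>\<eta> z\<close> or 0; it is 0 only at \<open>z = - 1\<close> or
  \<open>z = 1\<close>, where the fibre is a single point. For an empty fibre
  \<open>t\<^sup>2 - 4\<close> is a nonsquare and the two terms cancel.\<close>

lemma sum_eta_reciprocal_fibre: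
  "(\<Sum>z | z \<in> UNIV - {0} \<and> z + inverse z = t. \<eta> z) = \<eta> (t + 2) + \<eta> (t - 2)"
proof (cases "\<exists>z. z \<noteq> 0 \<and> z + inverse z = t")
  case True
  then obtain z where z: "z \<noteq> 0" "t = z + inverse z" by blast
  have set: "{y. y \<in> UNIV - {0} \<and> y + inverse y = t} = {z, inverse z}"
  proof (intro equalityI subsetI)
    fix y assume "y \<in> {y. y \<in> UNIV - {0} \<and> y + inverse y = t}"
    then have y: "y \<noteq> 0" "y + inverse y = z + inverse z" using z by auto
    then have "(y - z) * (y * z - 1) = 0" using z by (simp add: field_simps)
    then have "y = z \<or> y * z = 1" by simp
    then show "y \<in> {z, inverse z}" using inverse_unique[of z y] by (auto simp: mult.commute)
  qed (use z in \<open>auto simp: add.commute\<close>)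
  have plus: "z * (t + 2) = (z + 1)\<^sup>2" and minus: "z * (t - 2) = (z - 1)\<^sup>2"
    using z by (simp_all add: field_simps power2_eq_square)
  have eta: "\<eta> (t + e) = \<eta> z" if "z * (t + e) = (z + f)\<^sup>2" "z + f \<noteq> 0" for e f
  proof -
    have "\<eta> z * \<eta> (t + e) = 1" using that by (simp add: eta_power2 flip: eta_mult)
    then show ?thesis using eta_cases[OF z(1)] by (auto simp: minus_equation_iff)
  qed
  consider "z = 1" | "z = - 1" | "z \<noteq> 1" "z \<noteq> - 1" by blast
  then show ?thesis
  proof cases
    case 1
    then have t: "t = 2" using z by simp
    have "\<eta> (2 + 2) = \<eta> (2\<^sup>2)" by (simp add: power2_eq_square)
    then have "\<eta> (2 + 2) = 1" using eta_power2[OF two_nz] by (simp only:)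
    then show ?thesis unfolding set unfolding t using 1 by simp
  next
    case 2
    then have t: "t = - 2" using z by simp
    have "\<eta> (- 2 - 2) = \<eta> (2\<^sup>2)" using eta_uminus[of 4] by (simp add: power2_eq_square)
    then have "\<eta> (- 2 - 2) = 1" using eta_power2[OF two_nz] by (simp only:)
    then show ?thesis unfolding set unfolding t using 2 by (simp add: eta_minus_1)
  next
    case 3
    have "z \<noteq> inverse z"
    proof
      assume "z = inverse z"
      then have "z\<^sup>2 = 1" using z by (metis power2_eq_square right_inverse)
      then show False using 3 by (simp add: power2_eq_1_iff)
    qed
    moreover have "\<eta> (t + 2) = \<eta> z" by (rule eta[OF plus]) (use 3 in \<open>simp add: add_eq_0_iff2\<close>)
    moreover have "\<eta> (t - 2) = \<eta> z" using eta[of "- 2" "- 1"] minus 3 by simp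
    ultimately show ?thesis unfolding set by (simp add: eta_inverse)
  qed
next
  case False
  then have "{z. z \<in> UNIV - {0} \<and> z + inverse z = t} = {}" by auto
  moreover have nsq: "t\<^sup>2 - 4 \<noteq> d\<^sup>2" for d
  proof
    assume d: "t\<^sup>2 - 4 = d\<^sup>2"
    \<comment> \<open>A root of \<open>z\<^sup>2 - t * z + 1\<close>, whose other root
      \<open>(t - d) / 2\<close> is its inverse.\<close>
    define z where "z = (t + d) / 2"
    have 4: "(4::'a) \<noteq> 0" using two_nz by (metis mult_2 numeral_Bit0 mult_eq_0_iff)
    have "z * ((t - d) / 2) = (t\<^sup>2 - d\<^sup>2) / 4"
      by (simp add: z_def power2_eq_square algebra_simps)
    also have "t\<^sup>2 - d\<^sup>2 = 4" using d by (simp add: algebra_simps)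
    finally have "z * ((t - d) / 2) = 1" using 4 by simp
    then have "inverse z = (t - d) / 2" by (rule inverse_unique)
    moreover have "z \<noteq> 0" using \<open>z * ((t - d) / 2) = 1\<close> by auto
    moreover have "z + (t - d) / 2 = t" using two_nz by (simp add: z_def flip: add_divide_distrib mult_2)
    ultimately show False using False by metis
  qed
  have "\<eta> (t + 2) + \<eta> (t - 2) = 0"
  proof -
    have prod: "(t + 2) * (t - 2) = t\<^sup>2 - 4" by (simp add: power2_eq_square algebra_simps)
    have nz: "(t + 2) * (t - 2) \<noteq> 0" unfolding prod using nsq[of 0] by simp
    have "\<eta> ((t + 2) * (t - 2)) \<noteq> 1" unfolding prod by (metis eta_eq_1_imp_square nsq)
    then show ?thesis using nz eta_cases[of "t + 2"] eta_cases[of "t - 2"] by (auto simp: eta_mult)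
  qed
  ultimately show ?thesis by (simp only: sum.empty)
qed

lemma sum_eta_reciprocal:
  "(\<Sum>z\<in>UNIV - {0}. \<eta> z * h (z + inverse z)) = (\<Sum>t\<in>UNIV. (\<eta> (t + 2) + \<eta> (t - 2)) * h t)"
proof -
  have "(\<Sum>z\<in>UNIV - {0}. \<eta> z * h (z + inverse z))
      = (\<Sum>t\<in>UNIV. \<Sum>z | z \<in> UNIV - {0} \<and> z + inverse z = t. \<eta> z * h (z + inverse z))"
    by (rule sum.group[symmetric]) auto
  also have "\<dots> = (\<Sum>t\<in>UNIV. (\<Sum>z | z \<in> UNIV - {0} \<and> z + inverse z = t. \<eta> z) * h t)"
    unfolding sum_distrib_right by (intro sum.cong) auto
  finally show ?thesis unfolding sum_eta_reciprocal_fibre .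
qed

text \<open>The conjugate is written as \<open>\<chi>\<close> of an inverse, the form that
  \<open>gauss_twist\<close> produces.\<close>

definition twisted_term :: "'a \<Rightarrow> 'a \<Rightarrow> complex" where
  "twisted_term x y = \<eta> y * \<chi> (T (y * x)) * \<chi> (inverse (T (inverse y * x)))"

lemma twisted_term_scale:
  assumes "c \<in> F" "c \<noteq> 0" shows "twisted_term x (c * y) = twisted_term x y"
proof -
  have "T (c * y * x) = c * T (y * x)" using T_scale[OF assms(1)] by (simp add: mult.assoc)
  moreover have "T (inverse (c * y) * x) = inverse c * T (inverse y * x)"
    using T_scale[OF F_closed(6)[OF assms(1)]] by (simp add: mult.assoc)
  ultimately have "twisted_term x (c * y) = \<eta> c * (\<chi> c * \<chi> c) * twisted_term x y"
    by (simp add: twisted_term_def eta_mult chi_mult)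
  also have "\<eta> c * (\<chi> c * \<chi> c) = 1"
    using eta_square[OF assms(2)] by (simp add: chi2_def power2_eq_square)
  finally show ?thesis by simp
qed

end

context cubic_extension_char
begin

lemma gaussE_shift_twist:
  assumes "c \<noteq> 0"
  shows "(\<Sum>t\<in>UNIV. \<eta> (t + e) * \<Psi> (c * t)) = \<eta> c * gaussE * \<Psi> (- (c * e))"
proof -
  have "(\<Sum>t\<in>UNIV. \<eta> (t + e) * \<Psi> (c * t)) = (\<Sum>t\<in>UNIV. \<eta> t * \<Psi> (c * (t - e)))"
    using sum_E_shift[of "\<lambda>t. \<eta> t * \<Psi> (c * (t - e))" e] by simp
  also have "\<dots> = (\<Sum>t\<in>UNIV. \<eta> t * \<Psi> (c * t) * \<Psi> (- (c * e)))"
  proof (rule sum.cong)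
    fix t
    have "c * (t - e) = c * t + - (c * e)" by (simp add: right_diff_distrib)
    then show "\<eta> t * \<Psi> (c * (t - e)) = \<eta> t * \<Psi> (c * t) * \<Psi> (- (c * e))" by (simp only: Psi_add mult.assoc)
  qed simp
  finally show ?thesis using gaussE_twist[OF assms] by (simp flip: sum_distrib_right)
qed

text \<open>If \<open>a * b\<close> is a nonsquare, the involution
  \<open>y \<mapsto> b / (a * y)\<close> swaps the two summands inside \<open>\<Psi>\<close> and
  reverses the sign of \<open>\<eta> y\<close>, so the sum is 0. If
  \<open>a * b = c\<^sup>2\<close>, putting \<open>y = b / c * z\<close> turns the argument into
  \<open>c * (z + inverse z)\<close>, and \<open>sum_eta_reciprocal\<close> leaves two shifted Gauss
  sums.\<close>

lemma salie_sum:
  assumes a: "a \<noteq> 0" and b: "b \<noteq> 0"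
  shows "(\<Sum>y\<in>UNIV - {0}. \<eta> y * \<Psi> (a * y + b * inverse y)) = \<eta> b * gaussE * (\<Sum>c | c\<^sup>2 = a * b. \<Psi> (2 * c))"
    (is "?S = _")
proof (cases "\<eta> (a * b) = 1")
  case False
  then have ab: "\<eta> (b / a) = - 1" using eta_cases[of "a * b"] a b by (auto simp: eta_mult eta_divide mult.commute)
  have "?S = (\<Sum>y\<in>UNIV - {0}. \<eta> (b / (a * y)) * \<Psi> (a * (b / (a * y)) + b * inverse (b / (a * y))))"
    by (rule sum.reindex_bij_witness[of _ "\<lambda>y. b / (a * y)" "\<lambda>y. b / (a * y)"]) (use a b in auto)
  also have "\<dots> = (\<Sum>y\<in>UNIV - {0}. - (\<eta> y * \<Psi> (a * y + b * inverse y)))"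
  proof (rule sum.cong)
    fix y :: 'a assume "y \<in> UNIV - {0}"
    then have "a * (b / (a * y)) + b * inverse (b / (a * y)) = a * y + b * inverse y"
      using a b by (simp add: field_simps)
    moreover have "\<eta> (b / (a * y)) = \<eta> (b / a) * \<eta> y" by (simp add: eta_divide eta_mult)
    ultimately show "\<eta> (b / (a * y)) * \<Psi> (a * (b / (a * y)) + b * inverse (b / (a * y)))
        = - (\<eta> y * \<Psi> (a * y + b * inverse y))" using ab by simp
  qed simp
  finally have "?S = - ?S" by (simp add: sum_negf)
  then have "?S = 0" by simp
  moreover have "c\<^sup>2 \<noteq> a * b" for c using False a b eta_power2[of c] by (cases "c = 0") auto
  ultimately show ?thesis by (simp only: Collect_const) simp
next
  case True
  then obtain c where c: "c\<^sup>2 = a * b" "c \<noteq> 0" by (rule eta_eq_1_imp_square)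
  have "?S = (\<Sum>z\<in>UNIV - {0}. \<eta> (b / c * z) * \<Psi> (a * (b / c * z) + b * inverse (b / c * z)))"
    by (rule sum.reindex_bij_witness[of _ "\<lambda>z. b / c * z" "\<lambda>y. y / (b / c)"]) (use b c in auto)
  also have "\<dots> = (\<Sum>z\<in>UNIV - {0}. \<eta> b * \<eta> c * (\<eta> z * \<Psi> (c * (z + inverse z))))"
  proof (rule sum.cong)
    fix z :: 'a assume z: "z \<in> UNIV - {0}"
    have "a * (b / c) = c" using c by (simp add: power2_eq_square field_simps)
    then have "a * (b / c * z) = c * z" by (metis mult.assoc)
    moreover have "b * inverse (b / c * z) = c * inverse z" using b c z by (simp add: field_simps)
    ultimately show "\<eta> (b / c * z) * \<Psi> (a * (b / c * z) + b * inverse (b / c * z))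
        = \<eta> b * \<eta> c * (\<eta> z * \<Psi> (c * (z + inverse z)))"
      by (simp only: eta_mult eta_divide distrib_left mult.assoc)
  qed simp
  also have "\<dots> = \<eta> b * \<eta> c * (\<Sum>t\<in>UNIV. (\<eta> (t + 2) + \<eta> (t - 2)) * \<Psi> (c * t))"
    unfolding sum_distrib_left[symmetric] sum_eta_reciprocal[of "\<lambda>t. \<Psi> (c * t)"] ..
  also have "(\<Sum>t\<in>UNIV. (\<eta> (t + 2) + \<eta> (t - 2)) * \<Psi> (c * t)) = \<eta> c * gaussE * (\<Psi> (2 * c) + \<Psi> (2 * - c))"
  proof -
    have "(\<Sum>t\<in>UNIV. \<eta> (t + 2) * \<Psi> (c * t)) = \<eta> c * gaussE * \<Psi> (2 * - c)"
      using gaussE_shift_twist[OF c(2), of 2] by (simp add: mult.commute)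
    moreover have "(\<Sum>t\<in>UNIV. \<eta> (t - 2) * \<Psi> (c * t)) = \<eta> c * gaussE * \<Psi> (2 * c)"
      using gaussE_shift_twist[OF c(2), of "- 2"] by (simp add: mult.commute)
    ultimately show ?thesis by (simp only: distrib_right distrib_left sum.distrib add.commute)
  qed
  also have "\<Psi> (2 * c) + \<Psi> (2 * - c) = (\<Sum>d\<in>{c, - c}. \<Psi> (2 * d))"
  proof -
    have "c \<noteq> - c" using c two_nz by (simp add: eq_neg_iff_add_eq_0 flip: mult_2)
    then show ?thesis by simp
  qed
  also have "{c, - c} = {d. d\<^sup>2 = a * b}" unfolding c(1)[symmetric] by (auto simp: power2_eq_iff)
  finally show ?thesis using eta_square[OF c(2)] by (simp add: mult.assoc)
qed

text \<open>The square roots of \<open>(s * x) * (t * x)\<close> are \<open>r * x\<close> with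
  \<open>r\<^sup>2 = s * t\<close>, and \<open>sqrt_in_F\<close> puts \<open>r\<close> into
  \<open>F\<close>. The condition is solved for \<open>t\<close> so that a later sum over
  \<open>t\<close> merges into one over all \<open>r\<close>.\<close>

lemma salie_sum_scaled:
  assumes x: "x \<noteq> 0" and s: "s \<in> F" "s \<noteq> 0" and t: "t \<in> F" "t \<noteq> 0"
  shows "(\<Sum>y\<in>UNIV - {0}. \<eta> y * \<Psi> ((s * x) * y + (t * x) * inverse y))
     = \<eta> t * \<eta> x * gaussE * (\<Sum>r | r \<in> F - {0} \<and> r\<^sup>2 / s = t. \<psi> (r * (2 * T x)))"
proof -
  have "(\<Sum>c | c\<^sup>2 = (s * x) * (t * x). \<Psi> (2 * c)) = (\<Sum>r | r \<in> F - {0} \<and> r\<^sup>2 / s = t. \<psi> (r * (2 * T x)))"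
  proof (rule sum.reindex_bij_witness[of _ "\<lambda>r. r * x" "\<lambda>c. c / x"])
    fix c assume c: "c \<in> {c. c\<^sup>2 = (s * x) * (t * x)}"
    then have st: "(c / x)\<^sup>2 = s * t" using x by (simp add: power2_eq_square field_simps)
    have F: "c / x \<in> F" by (rule sqrt_in_F, subst st) (rule F_closed(3)[OF s(1) t(1)])
    show "c / x * x = c" using x by simp
    show "c / x \<in> {r. r \<in> F - {0} \<and> r\<^sup>2 / s = t}" using F st s t by auto
    have "2 * c = (c / x * 2) * x" using x by simp
    then have "T (2 * c) = (c / x * 2) * T x" using F by (metis T_scale F_closed(3) numeral_F)
    then show "\<psi> (c / x * (2 * T x)) = \<Psi> (2 * c)" by (simp add: \<Psi>_def mult.assoc)
  next
    fix r assume r: "r \<in> {r. r \<in> F - {0} \<and> r\<^sup>2 / s = t}"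
    then show "r * x / x = r" using x by simp
    show "r * x \<in> {c. c\<^sup>2 = (s * x) * (t * x)}" using r s by (auto simp: power2_eq_square field_simps)
  qed
  then show ?thesis using salie_sum[of "s * x" "t * x"] x s t by (simp add: eta_mult)
qed

text \<open>Multiplying by the two Gauss sums expands both values of \<open>\<chi>\<close>, and the
  sum over \<open>y\<close> becomes a Salie sum for each pair \<open>s\<close>,
  \<open>t\<close>.\<close>

lemma sum_twisted_term_gauss:
  assumes x: "x \<noteq> 0"
  shows "gauss (\<lambda>x. \<chi> (inverse x)) * gauss \<chi> * (\<Sum>y\<in>UNIV - {0}. twisted_term x y)
    = of_nat (q - 1) * (\<eta> x * gaussE * (\<eta> 2 * \<eta> (T x) * gauss \<eta>))"
proof -
  let ?\<chi>' = "\<lambda>x. \<chi> (inverse x)"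
  have "gauss ?\<chi>' * gauss \<chi> * (\<Sum>y\<in>UNIV - {0}. twisted_term x y)
      = (\<Sum>y\<in>UNIV - {0}. \<eta> y * (\<chi> (T (y * x)) * gauss ?\<chi>') * (\<chi> (inverse (T (inverse y * x))) * gauss \<chi>))"
    unfolding sum_distrib_left twisted_term_def by (rule sum.cong) simp_all
  also have "\<dots> = (\<Sum>y\<in>UNIV - {0}. \<eta> y * ((\<Sum>s\<in>F. ?\<chi>' s * \<psi> (s * T (y * x))) * (\<Sum>t\<in>F. \<chi> t * \<psi> (t * T (inverse y * x)))))"
    by (rule sum.cong) (simp_all add: gauss_twist[OF mult_char_chi] gauss_twist[OF mult_char_inverse[OF mult_char_chi]])
  also have "\<dots> = (\<Sum>y\<in>UNIV - {0}. \<Sum>s\<in>F. \<Sum>t\<in>F. ?\<chi>' s * \<chi> t * (\<eta> y * \<Psi> ((s * x) * y + (t * x) * inverse y)))"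
    unfolding sum_product unfolding sum_distrib_left
  proof (intro sum.cong refl)
    fix y s t assume st: "s \<in> F" "t \<in> F"
    have "T ((s * x) * y) = s * T (y * x)" "T ((t * x) * inverse y) = t * T (inverse y * x)"
      using st by (simp_all add: T_scale mult.assoc mult.commute[of x])
    then have "\<Psi> ((s * x) * y + (t * x) * inverse y) = \<psi> (s * T (y * x)) * \<psi> (t * T (inverse y * x))"
      by (simp only: Psi_add) (simp only: \<Psi>_def)
    then show "\<eta> y * (?\<chi>' s * \<psi> (s * T (y * x)) * (\<chi> t * \<psi> (t * T (inverse y * x))))
      = ?\<chi>' s * \<chi> t * (\<eta> y * \<Psi> ((s * x) * y + (t * x) * inverse y))" by simp
  qed
  also have "\<dots> = (\<Sum>s\<in>F. \<Sum>t\<in>F. ?\<chi>' s * \<chi> t * (\<Sum>y\<in>UNIV - {0}. \<eta> y * \<Psi> ((s * x) * y + (t * x) * inverse y)))"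
    unfolding sum_distrib_left by (subst sum.swap, rule sum.cong[OF refl], rule sum.swap)
  also have "\<dots> = (\<Sum>s\<in>F-{0}. \<Sum>t\<in>F. ?\<chi>' s * \<chi> t * (\<Sum>y\<in>UNIV - {0}. \<eta> y * \<Psi> ((s * x) * y + (t * x) * inverse y)))"
    by (rule sum.mono_neutral_right) auto
  also have "\<dots> = (\<Sum>s\<in>F-{0}. \<eta> x * gaussE * (\<eta> 2 * \<eta> (T x) * gauss \<eta>))"
  proof (rule sum.cong)
    fix s assume "s \<in> F - {0}"
    then have s: "s \<in> F" "s \<noteq> 0" by auto
    have "(\<Sum>t\<in>F. ?\<chi>' s * \<chi> t * (\<Sum>y\<in>UNIV - {0}. \<eta> y * \<Psi> ((s * x) * y + (t * x) * inverse y)))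
        = (\<Sum>t\<in>F-{0}. ?\<chi>' s * \<chi> t * (\<Sum>y\<in>UNIV - {0}. \<eta> y * \<Psi> ((s * x) * y + (t * x) * inverse y)))"
      by (rule sum.mono_neutral_right) auto
    also have "\<dots> = (\<Sum>t\<in>F-{0}. \<Sum>r | r \<in> F - {0} \<and> r\<^sup>2 / s = t. \<eta> x * gaussE * (\<eta> r * \<psi> (r * (2 * T x))))"
    proof (rule sum.cong)
      fix t assume t: "t \<in> F - {0}"
      have "?\<chi>' s * \<chi> t * (\<Sum>y\<in>UNIV - {0}. \<eta> y * \<Psi> ((s * x) * y + (t * x) * inverse y))
        = (\<Sum>r | r \<in> F - {0} \<and> r\<^sup>2 / s = t. ?\<chi>' s * \<chi> t * (\<eta> t * \<eta> x * gaussE) * \<psi> (r * (2 * T x)))"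
        using salie_sum_scaled[OF x s, of t] t by (simp add: sum_distrib_left mult.assoc)
      also have "\<dots> = (\<Sum>r | r \<in> F - {0} \<and> r\<^sup>2 / s = t. \<eta> x * gaussE * (\<eta> r * \<psi> (r * (2 * T x))))"
      proof (rule sum.cong)
        fix r assume "r \<in> {r. r \<in> F - {0} \<and> r\<^sup>2 / s = t}"
        then have r: "r \<in> F" "r \<noteq> 0" "t = r\<^sup>2 * inverse s" by (auto simp: divide_inverse)
        \<comment> \<open>With \<open>t = r\<^sup>2 / s\<close> the coefficient collapses to
          \<open>\<eta> r\<close>. As it no longer depends on \<open>s\<close>, the outer sum only
          contributes the factor \<open>q - 1\<close>.\<close>
        have "?\<chi>' s * \<chi> t * \<eta> t = (?\<chi>' s * ?\<chi>' s) * \<chi> (r\<^sup>2) * (\<eta> (r\<^sup>2) * \<eta> (inverse s))"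
          unfolding r(3) chi_mult eta_mult by simp
        also have "?\<chi>' s * ?\<chi>' s = \<eta> (inverse s)" by (simp add: chi2_def power2_eq_square)
        finally have "?\<chi>' s * \<chi> t * \<eta> t = \<eta> r"
          using eta_square[OF s(2)] by (simp add: eta_power2[OF r(2)] chi_power2 eta_inverse)
        then show "?\<chi>' s * \<chi> t * (\<eta> t * \<eta> x * gaussE) * \<psi> (r * (2 * T x)) = \<eta> x * gaussE * (\<eta> r * \<psi> (r * (2 * T x)))"
          by (simp add: mult.assoc[symmetric])
      qed simp
      finally show "?\<chi>' s * \<chi> t * (\<Sum>y\<in>UNIV - {0}. \<eta> y * \<Psi> ((s * x) * y + (t * x) * inverse y))
        = (\<Sum>r | r \<in> F - {0} \<and> r\<^sup>2 / s = t. \<eta> x * gaussE * (\<eta> r * \<psi> (r * (2 * T x))))" .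
    qed simp
    \<comment> \<open>For fixed \<open>s\<close>, each nonzero \<open>r\<close> belongs to exactly
      one \<open>t\<close>; what remains is the quadratic Gauss sum twisted by
      \<open>2 * T x\<close>.\<close>
    also have "\<dots> = (\<Sum>r\<in>F - {0}. \<eta> x * gaussE * (\<eta> r * \<psi> (r * (2 * T x))))"
      by (rule sum.group) (use s in auto)
    also have "\<dots> = (\<Sum>r\<in>F. \<eta> x * gaussE * (\<eta> r * \<psi> (r * (2 * T x))))"
      by (rule sum.mono_neutral_left) auto
    also have "\<dots> = \<eta> x * gaussE * (\<Sum>r\<in>F. \<eta> r * \<psi> (r * (2 * T x)))" by (rule sum_distrib_left[symmetric])
    also have "\<dots> = \<eta> x * gaussE * (\<eta> 2 * \<eta> (T x) * gauss \<eta>)"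
      by (subst gauss_twist[OF mult_char_eta]) (auto simp only: eta_inverse eta_mult intro!: F_closed numeral_F T_in_F)
    finally show "(\<Sum>t\<in>F. ?\<chi>' s * \<chi> t * (\<Sum>y\<in>UNIV - {0}. \<eta> y * \<Psi> ((s * x) * y + (t * x) * inverse y)))
      = \<eta> x * gaussE * (\<eta> 2 * \<eta> (T x) * gauss \<eta>)" .
  qed simp
  also have "\<dots> = of_nat (q - 1) * (\<eta> x * gaussE * (\<eta> 2 * \<eta> (T x) * gauss \<eta>))"
    by (simp add: card_F_units)
  finally show ?thesis .
qed

text \<open>The quartic Gauss sums multiply to \<open>\<chi> (- 1) * q\<close>, that is
  \<open>\<eta> 2 * q\<close>, and \<open>gaussE * gauss \<eta>\<close> is the square of
  \<open>q\<close>; the common factor \<open>\<eta> 2 * q\<close> cancels.\<close>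

lemma sum_twisted_term:
  assumes x: "x \<noteq> 0"
  shows "(\<Sum>y\<in>UNIV - {0}. twisted_term x y) = of_nat (q - 1) * (of_nat q * \<eta> x * \<eta> (T x))"
proof -
  have "(\<eta> 2 * of_nat q) * (\<Sum>y\<in>UNIV - {0}. twisted_term x y)
      = gauss (\<lambda>x. \<chi> (inverse x)) * gauss \<chi> * (\<Sum>y\<in>UNIV - {0}. twisted_term x y)"
    using gauss_mult_gauss_inverse[OF mult_char_chi] by (simp add: eta_2 mult.commute)
  also have "\<dots> = of_nat (q - 1) * (\<eta> x * gaussE * (\<eta> 2 * \<eta> (T x) * gauss \<eta>))"
    by (rule sum_twisted_term_gauss[OF x])
  also have "\<dots> = of_nat (q - 1) * (\<eta> x * of_nat q * \<eta> 2 * \<eta> (T x) * (gauss \<eta> * gauss \<eta>))"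
    by (simp add: gaussE_eq)
  also have "\<dots> = (\<eta> 2 * of_nat q) * (of_nat (q - 1) * (of_nat q * \<eta> x * \<eta> (T x)))"
    by (simp add: gauss_eta_square)
  finally show ?thesis
    using q_gt_1 eta_cases[OF two_nz] by (auto dest!: mult_left_cancel[THEN iffD1, rotated])
qed

end

section \<open>Counting with the powers of \<open>\<mu>\<close>\<close>

context cubic_extension
begin

abbreviation \<mu> :: 'a where "\<mu> \<equiv> \<alpha> ^ (q - 1)"

text \<open>A quotient of two powers of \<open>\<mu>\<close> lies in \<open>F\<close> only if
  \<open>N\<close> divides \<open>q - 1\<close> times the difference of exponents, hence by
  \<open>coprime_N\<close> the difference itself. Surjectivity follows from
  \<open>(q - 1) * N = q ^ 3 - 1\<close>.\<close>

lemma bij_units_times_mu_powers: "bij_betw (\<lambda>(c, i). c * \<mu> ^ i) ((F - {0}) \<times> {..<N}) (UNIV - {0})"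
proof -
  let ?A = "(F - {0}) \<times> {..<N}" and ?f = "\<lambda>(c, i). c * \<mu> ^ i"
  have key: "i = j" if ij: "i \<le> j" "j < N" and cd: "c \<in> F - {0}" "d \<in> F - {0}" and eq: "c * \<mu> ^ i = d * \<mu> ^ j" for c d i j
  proof -
    have "\<mu> ^ j = \<mu> ^ i * \<mu> ^ (j - i)" using ij(1) by (simp flip: power_add)
    then have "c * \<mu> ^ i = d * \<mu> ^ (j - i) * \<mu> ^ i" using eq by simp
    then have "c = d * \<mu> ^ (j - i)" using alpha_nz by simp
    then have "\<mu> ^ (j - i) = c / d" using cd by simp
    then have "\<mu> ^ (j - i) \<in> F" using cd by auto
    then have "N dvd (q - 1) * (j - i)" by (simp add: alpha_power_in_F flip: power_mult)
    then have "N dvd j - i" using coprime_N by (simp add: coprime_dvd_mult_right_iff)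
    then show "i = j" using ij by (metis diff_diff_cancel diff_zero dvd_imp_le less_imp_diff_less linorder_not_le nat_neq_iff zero_less_diff)
  qed
  have inj: "inj_on ?f ?A"
  proof (rule inj_onI)
    fix u v assume "u \<in> ?A" "v \<in> ?A" "?f u = ?f v"
    then obtain c i d j where uv: "u = (c, i)" "v = (d, j)"
      and *: "c \<in> F" "c \<noteq> 0" "i < N" "d \<in> F" "d \<noteq> 0" "j < N" "c * \<mu> ^ i = d * \<mu> ^ j" by auto
    have "i = j" using key[of i j c d] key[of j i d c] * by (cases "i \<le> j") auto
    then show "u = v" using * alpha_nz by (simp add: uv)
  qed
  have "?f ` ?A \<subseteq> UNIV - {0}" using alpha_nz by auto
  moreover have "card (?f ` ?A) = card (UNIV - {0::'a})"
    using card_image[OF inj] E_minus_1 by (simp add: card_cartesian_product card_F_units card_E card_Diff_singleton)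
  ultimately have "?f ` ?A = UNIV - {0}" by (intro card_subset_eq) auto
  then show ?thesis using inj by (simp add: bij_betw_def)
qed

definition kappa_term :: "'a \<Rightarrow> nat \<Rightarrow> complex" where
  "kappa_term x i = \<chi> (T (\<mu> ^ i * x)) * cnj (\<chi> (T (inverse \<mu> ^ i * x)))"

text \<open>As \<open>q - 1\<close> is even, \<open>\<mu>\<close> is a square and the factor
  \<open>\<eta>\<close> is 1.\<close>

lemma twisted_term_mu: "twisted_term x (\<mu> ^ i) = kappa_term x i"
proof -
  obtain k where "q = 4 * k + 1" by (rule q_obtain)
  then have "even ((q - 1) * i)" by simp
  then have "\<eta> (\<mu> ^ i) = 1" by (simp add: eta_alpha_power flip: power_mult)
  then show ?thesis by (simp add: twisted_term_def kappa_term_def cnj_chi power_inverse)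
qed

text \<open>Each term is a single value of \<open>\<chi>\<close>. On these values the real part is
  the indicator of 1 minus the indicator of -1, so the real part of the sum is the difference of the
  two counts.\<close>

lemma kappa_term_cases: "kappa_term x i \<in> {0, 1, - 1, \<i>, - \<i>}"
proof -
  have "\<chi> z \<in> {0, 1, - 1, \<i>, - \<i>}" for z
  proof (cases "z = 0")
    case False
    then obtain m where "z = \<alpha> ^ m" by (rule obtain_log)
    moreover have "\<i> ^ k \<in> {0, 1, - 1, \<i>, - \<i>}" for k by (induction k) auto
    ultimately show ?thesis by (simp only: chi_alpha_power)
  qed simp
  then show ?thesis unfolding kappa_term_def cnj_chi chi_mult[symmetric] .
qed

end

context cubic_extension_char
begin

lemma sum_kappa_term:
  assumes "x \<noteq> 0" shows "(\<Sum>i<N. kappa_term x i) = of_nat q * \<eta> x * \<eta> (T x)"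
proof -
  have "(\<Sum>y\<in>UNIV - {0}. twisted_term x y) = (\<Sum>(c, i)\<in>(F - {0}) \<times> {..<N}. twisted_term x (c * \<mu> ^ i))"
    using sum.reindex_bij_betw[OF bij_units_times_mu_powers, of "twisted_term x"] by (simp add: case_prod_beta)
  also have "\<dots> = (\<Sum>(c, i)\<in>(F - {0}) \<times> {..<N}. kappa_term x i)"
  proof (rule sum.cong)
    fix v assume "v \<in> (F - {0}) \<times> {..<N}"
    then obtain c i where "v = (c, i)" "c \<in> F" "c \<noteq> 0" by blast
    then show "(case v of (c, i) \<Rightarrow> twisted_term x (c * \<mu> ^ i)) = (case v of (c, i) \<Rightarrow> kappa_term x i)"
      using twisted_term_scale[of c x "\<mu> ^ i"] twisted_term_mu[of x i] by simp
  qed simp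
  also have "\<dots> = of_nat (q - 1) * (\<Sum>i<N. kappa_term x i)"
    by (simp add: card_F_units flip: sum.cartesian_product)
  finally have "of_nat (q - 1) * (\<Sum>i<N. kappa_term x i) = of_nat (q - 1) * (of_nat q * \<eta> x * \<eta> (T x))"
    using sum_twisted_term[OF assms] by (simp only:)
  moreover have "of_nat (q - 1) \<noteq> (0::complex)" using q_gt_1 by simp
  ultimately show ?thesis by (metis mult_left_cancel)
qed

lemma kappa_difference:
  assumes "x \<noteq> 0"
  shows "of_nat (kappa q \<alpha> 1 x) - of_nat (kappa q \<alpha> (- 1) x) = of_nat q * \<eta> x * \<eta> (T x)"
proof -
  have kappa: "kappa q \<alpha> z x = card {i. i < N \<and> kappa_term x i = z}" for z
    unfolding kappa_def kappa_term_def N_def Let_def ..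
  have card: "real (kappa q \<alpha> z x) = (\<Sum>i<N. if kappa_term x i = z then 1 else 0)" for z
    unfolding kappa by (simp add: sum.If_cases Int_def)
  have "real (kappa q \<alpha> 1 x) - real (kappa q \<alpha> (- 1) x) = (\<Sum>i<N. Re (kappa_term x i))"
    unfolding card sum_subtractf[symmetric]
  proof (rule sum.cong)
    fix i
    show "(if kappa_term x i = 1 then 1 else 0) - (if kappa_term x i = - 1 then 1 else 0) = Re (kappa_term x i)"
      using kappa_term_cases[of x i] by (auto simp: complex_eq_iff)
  qed simp
  also have "\<dots> = Re (of_nat q * \<eta> x * \<eta> (T x))"
    using sum_kappa_term[OF assms] by (metis Re_sum)
  finally have "complex_of_real (real (kappa q \<alpha> 1 x) - real (kappa q \<alpha> (- 1) x))
      = complex_of_real (Re (of_nat q * \<eta> x * \<eta> (T x)))" by simp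
  also have "\<dots> = of_nat q * \<eta> x * \<eta> (T x)"
  proof -
    \<comment> \<open>The right-hand side is real, so passing to real parts loses nothing.\<close>
    have "\<eta> (T x) \<in> {0, 1, - 1}" using eta_cases[of "T x"] by (cases "T x = 0") auto
    then show ?thesis using eta_cases[OF assms] by (auto simp: complex_eq_iff)
  qed
  finally show ?thesis by simp
qed

end

theorem mainTheorem6:
  fixes q :: nat and \<alpha> x :: "'a::{field,finite}"
  assumes "primepow q" and "[q = 1] (mod 4)" and "\<not> [q = 1] (mod 3)"
    and "CARD('a) = q ^ 3"
    and "primitive_element \<alpha>"
    and "x \<noteq> 0"
  shows "of_nat (kappa q \<alpha> 1 x) - of_nat (kappa q \<alpha> (- 1) x)
       = of_nat q * chi2 \<alpha> x * chi2 \<alpha> (trace3 q x)"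
proof -
  obtain p n where p: "prime p" "q = p ^ n" using assms(1) by (auto simp: primepow_def)
  \<comment> \<open>The characteristic divides the cardinality, so it is the prime whose power
    \<open>q\<close> is.\<close>
  have "CHAR('a) dvd p ^ (n * 3)"
    using CHAR_dvd_CARD[where 'a='a] assms(4) p by (simp add: power_mult)
  then have "CHAR('a) dvd p" using prime_CHAR_finite prime_dvd_power by blast
  then have "CHAR('a) = p" using p prime_CHAR_finite primes_dvd_imp_eq by blast
  then interpret cubic_extension q n \<alpha> using assms p by unfold_locales auto
  \<comment> \<open>The existence of the character requires \<open>card_F\<close>, which the first
    interpretation supplies; hence two interpretations in succession.\<close>
  obtain \<psi> :: "'a \<Rightarrow> complex" where \<psi>: "\<forall>a b. a ^ q = a \<longrightarrow> b ^ q = b \<longrightarrow> \<psi> (a + b) = \<psi> a * \<psi> b"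
      "\<psi> 0 = 1" "\<exists>t. t ^ q = t \<and> \<psi> t \<noteq> 1"
    using exists_nontrivial_additive_character[OF q_eq _ q_gt_1] card_F unfolding F_def by blast
  interpret cubic_extension_char q n \<alpha> \<psi> using \<psi> by unfold_locales (auto simp: F_def)
  show ?thesis by (rule kappa_difference[OF assms(6)])
qed

end
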